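(* Let $n,r$ be positive integers. The basic $r$-symmetric tropical polynomials generate the semifield of $S_n$-invariant tropical rational functions on $\mathbb{R}^{n\times r}$: for every $S_n$-invariant tropical rational function $f$ on $\mathbb{R}^{n\times r}$ there is a tropical rational function $g$ on $\mathbb{R}^K$ with $f=g\circ\Phi$. One may take $$g(w)=\min_{\vec\sigma\in S_n^{\,r-1}}\Bigl[f\bigl(R_{\vec\sigma}(s(w))\bigr)+\kappa_f\,D_{\vec\sigma}(w)\Bigr],\qquad w\in\mathbb{R}^K,$$ for every sufficiently large integer $\kappa_f$ (i.e. for each such $f$ there is a threshold such that for every integer $\kappa_f$ above the threshold this $g$ is tropical rational and satisfies $f=g\circ\Phi$).
   Context: $\mathbb{N}=\{0,1,2,\dots\}$. The symmetric group $S_n$ acts on $\mathbb{R}^{n\times r}$ by permuting rows. For $M=(m_{i\alpha})\in\mathbb{R}^{n\times r}$ and $c\in\mathbb{N}^r$ with $0<|c|:=c_1+\cdots+c_r\le n$, the basic $r$-symmetric tropical polynomial (basic value) is $$b_c(M)=\max\Bigl\{\sum_{\alpha=1}^r\sum_{i\in I_\alpha} m_{i\alpha} : I_1,\dots,I_r\subseteq\{1,\dots,n\}\text{ pairwise disjoint},\ \#I_\alpha=c_\alpha\Bigr\},$$ and $b_0=0$. Put $K=\binom{n+r}{r}-1$ and $\Phi=(b_c)_{0<|c|\le n}:\mathbb{R}^{n\times r}\to\mathbb{R}^K$; coordinates of $w\in\mathbb{R}^K$ are written $w_c$, $0<|c|\le n$, and $w_0:=0$. The map $s:\mathbb{R}^K\to\mathbb{R}^{n\times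 r}$ is $s(w)_{i\alpha}:=w_{ie_\alpha}-w_{(i-1)e_\alpha}$, with $e_\alpha$ the $\alpha$th standard basis vector of $\mathbb{N}^r$. For a coupling $\vec\sigma=(\sigma_2,\dots,\sigma_r)\in S_n^{\,r-1}$ and $U\in\mathbb{R}^{n\times r}$ with columns $U^{(1)},\dots,U^{(r)}$, $R_{\vec\sigma}(U)$ is the matrix whose $i$th row is $(U^{(1)}_i,U^{(2)}_{\sigma_2(i)},\dots,U^{(r)}_{\sigma_r(i)})$. The recoupling discriminant is $$D_{\vec\sigma}(w):=\max_{0<|c|\le n}\bigl|w_c-b_c(R_{\vec\sigma}(s(w)))\bigr|,\qquad w\in\mathbb{R}^K.$$ A tropical polynomial on $\mathbb{R}^m$ is a finite maximum of functions $z\mapsto\gamma+\sum_i a_iz_i$ with $\gamma\in\mathbb{R}$, $a\in\mathbb{Z}_{\ge0}^m$. A tropical rational function is a difference of two tropical polynomials, regarded as a function. These form a semifield under $\max$, $+$, $-$ (as addition, multiplication, division). *)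

theory Defs
  imports Complex_Main "HOL-Library.FuncSet" "HOL-Library.Disjoint_Sets"
    "HOL-Combinatorics.Permutations"
begin

text \<open>
  A point of the real vector space with finite coordinate set \<open>I\<close> is given by any
  \<open>z :: 'v \<Rightarrow> real\<close>; only the values \<open>z v\<close> with \<open>v \<in> I\<close> are coordinates of the point.
  Functions on that space are functions of \<open>z\<close> that ignore the values outside \<open>I\<close>.
  By its explicit form every member of \<open>trop_poly I\<close> and \<open>trop_rat I\<close> is of this kind, so
  equality in HOL of two such functions is their equality as functions on the space.
\<close>

definition trop_poly :: "'v set \<Rightarrow> (('v \<Rightarrow> real) \<Rightarrow> real) set" where
  "trop_poly I =
     {F. \<exists>T :: (real \<times> ('v \<Rightarrow> nat)) set. finite T \<and> T \<noteq> {} \<and>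
           F = (\<lambda>z. Max ((\<lambda>(\<gamma>, a). \<gamma> + (\<Sum>v\<in>I. real (a v) * z v)) ` T))}"

definition trop_rat :: "'v set \<Rightarrow> (('v \<Rightarrow> real) \<Rightarrow> real) set" where
  "trop_rat I = {f. \<exists>p\<in>trop_poly I. \<exists>q\<in>trop_poly I. f = (\<lambda>z. p z - q z)}"

text \<open>
  The semifield generated by \<open>G\<close> over the real constants. Semifield addition, multiplication
  and division are pointwise \<open>max\<close>, \<open>+\<close> and \<open>-\<close>. The constants belong to it because
  tropical polynomials have arbitrary real coefficients \<open>\<gamma>\<close>.
\<close>

inductive_set trop_semifield :: "('z \<Rightarrow> real) set \<Rightarrow> ('z \<Rightarrow> real) set"
  for G :: "('z \<Rightarrow> real) set"
  where
    gen: "f \<in> G \<Longrightarrow> f \<in> trop_semifield G"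
  | const: "(\<lambda>_. \<gamma>) \<in> trop_semifield G"
  | max: "f \<in> trop_semifield G \<Longrightarrow> g \<in> trop_semifield G
      \<Longrightarrow> (\<lambda>z. max (f z) (g z)) \<in> trop_semifield G"
  | plus: "f \<in> trop_semifield G \<Longrightarrow> g \<in> trop_semifield G
      \<Longrightarrow> (\<lambda>z. f z + g z) \<in> trop_semifield G"
  | minus: "f \<in> trop_semifield G \<Longrightarrow> g \<in> trop_semifield G
      \<Longrightarrow> (\<lambda>z. f z - g z) \<in> trop_semifield G"

text \<open>
  An \<open>n \<times> r\<close> matrix is a point with coordinate set \<open>mat_idx n r\<close>; rows and columns are
  numbered from 1.
\<close>

type_synonym rmat = "nat \<times> nat \<Rightarrow> real"

definition mat_idx :: "nat \<Rightarrow> nat \<Rightarrow> (nat \<times> nat) set" where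
  "mat_idx n r = {1..n} \<times> {1..r}"

definition permute_rows :: "(nat \<Rightarrow> nat) \<Rightarrow> rmat \<Rightarrow> rmat" where
  "permute_rows \<pi> M = (\<lambda>(i, \<alpha>). M (\<pi> i, \<alpha>))"

text \<open>
  The condition ranges over the whole group, so it does not depend on whether \<open>\<pi>\<close> or its
  inverse is used in \<open>permute_rows\<close>.
\<close>

definition sym_trop_rat :: "nat \<Rightarrow> nat \<Rightarrow> (rmat \<Rightarrow> real) set" where
  "sym_trop_rat n r =
     {f \<in> trop_rat (mat_idx n r). \<forall>\<pi>. \<pi> permutes {1..n} \<longrightarrow> (\<forall>M. f (permute_rows \<pi> M) = f M)}"

text \<open>
  Exponents \<open>c\<close> in the \<open>r\<close>-fold power of the natural numbers are functions \<open>nat \<Rightarrow> nat\<close>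
  vanishing outside \<open>{1..r}\<close>. The coordinate set of the target space of \<open>Phi\<close> below
  consists of those with \<open>0 < \<bar>c\<bar> \<le> n\<close>.
\<close>

definition exp_idx :: "nat \<Rightarrow> nat \<Rightarrow> (nat \<Rightarrow> nat) set" where
  "exp_idx n r = {c. (\<forall>\<alpha>. \<alpha> \<notin> {1..r} \<longrightarrow> c \<alpha> = 0) \<and>
                     0 < (\<Sum>\<alpha>=1..r. c \<alpha>) \<and> (\<Sum>\<alpha>=1..r. c \<alpha>) \<le> n}"

text \<open>The dimension of the target space.\<close>

lemma card_exp_idx: "card (exp_idx n r) = ((n + r) choose r) - 1"
proof -
  let ?A = "{l :: nat list. length l = Suc r \<and> sum_list l = n}"
  let ?B = "{c. (\<forall>\<alpha>. \<alpha> \<notin> {1..r} \<longrightarrow> c \<alpha> = 0) \<and> (\<Sum>\<alpha>=1..r. c \<alpha>) \<le> n} :: (nat \<Rightarrow> nat) set"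
  let ?f = "\<lambda>c. (n - (\<Sum>\<alpha>=1..r. c \<alpha>)) # map c [1..<Suc r]"
  let ?g = "\<lambda>l \<alpha>. if \<alpha> \<in> {1..r} then l ! \<alpha> else (0::nat)"
  have sum_upt: "sum_list (map c [1..<Suc r]) = (\<Sum>\<alpha>=1..r. c \<alpha>)" for c :: "nat \<Rightarrow> nat"
    by (simp only: interv_sum_list_conv_sum_set_nat set_upt atLeastLessThanSuc_atLeastAtMost)
  have tl: "map (?g l) [1..<Suc r] = tl l" if "length l = Suc r" for l :: "nat list"
    using that by (intro nth_equalityI) (auto simp: nth_tl simp del: upt_Suc)
  have "bij_betw ?f ?B ?A"
  proof (rule bij_betw_byWitness[where f' = ?g])
    show "\<forall>c\<in>?B. ?g (?f c) = c"
      by (auto simp: fun_eq_iff nth_Cons' simp del: upt_Suc)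
    show "\<forall>l\<in>?A. ?f (?g l) = l"
    proof
      fix l assume l: "l \<in> ?A"
      then obtain x xs where xs: "l = x # xs" by (cases l) auto
      have "(\<Sum>\<alpha>=1..r. ?g l \<alpha>) = sum_list xs"
        using sum_upt[of "?g l"] tl[of l] l xs by simp
      then show "?f (?g l) = l" using tl[of l] l xs by (auto simp del: upt_Suc)
    qed
    show "?f ` ?B \<subseteq> ?A" using sum_upt by (auto simp del: upt_Suc)
    show "?g ` ?A \<subseteq> ?B"
    proof
      fix c assume "c \<in> ?g ` ?A"
      then obtain l where l: "l \<in> ?A" "c = ?g l" by auto
      then obtain x xs where xs: "l = x # xs" by (cases l) auto
      have "(\<Sum>\<alpha>=1..r. c \<alpha>) = sum_list xs"
        using sum_upt[of "?g l"] tl[of l] l xs by simp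
      then show "c \<in> ?B" using l xs by auto
    qed
  qed
  then have "card ?B = card ?A" by (rule bij_betw_same_card)
  also have "\<dots> = (n + r) choose n"
    by (simp add: card_length_sum_list)
  also have "\<dots> = (n + r) choose r"
    using binomial_symmetric[of n "n + r"] by simp
  finally have B: "card ?B = (n + r) choose r" .
  have "exp_idx n r = ?B - {\<lambda>_. 0}"
    by (fastforce simp: exp_idx_def fun_eq_iff)
  then show ?thesis using B by (simp add: card_Diff_singleton)
qed

definition basic :: "nat \<Rightarrow> nat \<Rightarrow> (nat \<Rightarrow> nat) \<Rightarrow> rmat \<Rightarrow> real" where
  "basic n r c M =
     Max {\<Sum>\<alpha>=1..r. \<Sum>i\<in>S \<alpha>. M (i, \<alpha>) | S.
            disjoint_family_on S {1..r} \<and> (\<forall>\<alpha>\<in>{1..r}. S \<alpha> \<subseteq> {1..n} \<and> card (S \<alpha>) = c \<alpha>)}"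

definition Phi :: "nat \<Rightarrow> nat \<Rightarrow> rmat \<Rightarrow> (nat \<Rightarrow> nat) \<Rightarrow> real" where
  "Phi n r M = (\<lambda>c. basic n r c M)"

text \<open>The zero exponent is not in \<open>exp_idx n r\<close>; \<open>coord\<close> implements the convention that the
  corresponding coordinate is \<open>0\<close>.\<close>

definition coord :: "((nat \<Rightarrow> nat) \<Rightarrow> real) \<Rightarrow> (nat \<Rightarrow> nat) \<Rightarrow> real" where
  "coord w c = (if c = (\<lambda>_. 0) then 0 else w c)"

text \<open>\<open>mult_unit i \<alpha>\<close> is \<open>i\<close> times the \<open>\<alpha>\<close>th standard basis vector.\<close>

definition mult_unit :: "nat \<Rightarrow> nat \<Rightarrow> nat \<Rightarrow> nat" where
  "mult_unit i \<alpha> = (\<lambda>\<beta>. if \<beta> = \<alpha> then i else 0)"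

definition smap :: "((nat \<Rightarrow> nat) \<Rightarrow> real) \<Rightarrow> rmat" where
  "smap w = (\<lambda>(i, \<alpha>). coord w (mult_unit i \<alpha>) - coord w (mult_unit (i - 1) \<alpha>))"

definition couplings :: "nat \<Rightarrow> nat \<Rightarrow> (nat \<Rightarrow> nat \<Rightarrow> nat) set" where
  "couplings n r = {2..r} \<rightarrow>\<^sub>E {\<pi>. \<pi> permutes {1..n}}"

definition recouple :: "(nat \<Rightarrow> nat \<Rightarrow> nat) \<Rightarrow> rmat \<Rightarrow> rmat" where
  "recouple \<sigma> U = (\<lambda>(i, \<alpha>). if \<alpha> = 1 then U (i, 1) else U (\<sigma> \<alpha> i, \<alpha>))"

definition discriminant ::
  "nat \<Rightarrow> nat \<Rightarrow> (nat \<Rightarrow> nat \<Rightarrow> nat) \<Rightarrow> ((nat \<Rightarrow> nat) \<Rightarrow> real) \<Rightarrow> real" where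
  "discriminant n r \<sigma> w =
     Max ((\<lambda>c. \<bar>w c - basic n r c (recouple \<sigma> (smap w))\<bar>) ` exp_idx n r)"

definition recoupling_min ::
  "nat \<Rightarrow> nat \<Rightarrow> (rmat \<Rightarrow> real) \<Rightarrow> int \<Rightarrow> ((nat \<Rightarrow> nat) \<Rightarrow> real) \<Rightarrow> real" where
  "recoupling_min n r f \<kappa> w =
     Min ((\<lambda>\<sigma>. f (recouple \<sigma> (smap w)) + real_of_int \<kappa> * discriminant n r \<sigma> w) ` couplings n r)"

end

theory Submission
  imports Defs
begin

text \<open>
  The basic values of a matrix are symmetric, so everything they generate is symmetric. The
  substance is the converse, and it rests on a quantitative form of the fact that the basic values
  determine the rows up to order: if all basic values of \<open>M\<close> and \<open>N\<close> differ by at most \<open>\<epsilon>\<close>, then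
  some row permutation brings \<open>N\<close> within \<open>2 ^ (n + r + 1) * \<epsilon>\<close> of \<open>M\<close> entrywise
  (\<open>rows_matching\<close>). A tropical rational function is Lipschitz, so a symmetric one satisfies
  \<open>\<bar>f M - f N\<bar> \<le> K * \<epsilon>\<close> for a constant \<open>K\<close> (\<open>sym_trop_rat_Lipschitz_Phi\<close>).

  Given this bound the explicit formula is almost immediate. The map \<open>s\<close> applied to the basic
  values of \<open>M\<close> returns the columns of \<open>M\<close>, each sorted decreasingly, because the basic value at
  \<open>i\<close> times a unit vector is the sum of the \<open>i\<close> largest entries of a column. What is lost is how the
  columns are coupled into rows. One coupling restores the rows of \<open>M\<close>; it has discriminant \<open>0\<close>
  and contributes \<open>f M\<close> to the minimum (\<open>exists_recoupling\<close>). Any other coupling produces some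
  matrix \<open>N\<close> whose discriminant is the distance between the basic values of \<open>M\<close> and \<open>N\<close>, so
  \<open>f N + \<kappa> * D \<ge> f M\<close> once \<open>\<kappa> \<ge> K\<close>.

  For the quantitative statement, put a zero in front of each row \<open>m\<^sub>i\<close>, so that its index set
  becomes \<open>{0..r}\<close>. The function \<open>H\<^sub>M t = (\<Sum>i. Max\<^sub>\<beta> (t \<beta> + m\<^sub>i \<beta>))\<close> depends on \<open>M\<close> only through
  its basic values, and changes by at most \<open>\<epsilon>\<close> when they do (\<open>sum_row_Max_le\<close>). Taking a finite
  difference of step \<open>\<delta>\<close> in each of the \<open>r + 1\<close> coordinate directions turns the tropical linear form
  \<open>Max\<^sub>\<beta> t \<beta>\<close> into the bump \<open>max 0 (\<delta> - (Max t - Min t))\<close> up to sign (\<open>mixed_difference_Max\<close>):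
  away from the diagonal some coordinate does not influence the maximum, and the difference in its
  direction vanishes. As \<open>Max t - Min t\<close> defines a distance \<open>d\<close> between rows, the sums
  \<open>\<Sum>i. max 0 (\<delta> - d m\<^sub>i x)\<close> for \<open>M\<close> and \<open>N\<close> are close to each other for all \<open>\<delta>\<close> and \<open>x\<close>. A greedy
  choice of nearest rows then yields the matching (\<open>greedy_matching\<close>).
\<close>

section \<open>Tropical rational functions as a semifield\<close>

abbreviation coords :: "'v set \<Rightarrow> (('v \<Rightarrow> real) \<Rightarrow> real) set" where
  "coords I \<equiv> (\<lambda>v z. z v) ` I"

lemma semifield_sum:
  assumes "\<And>a. a \<in> A \<Longrightarrow> F a \<in> trop_semifield G"
  shows "(\<lambda>z. \<Sum>a\<in>A. F a z) \<in> trop_semifield G"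
  using assms
  by (induction A rule: infinite_finite_induct) (auto intro: trop_semifield.intros)

lemma semifield_of_nat_mult:
  assumes "f \<in> trop_semifield G"
  shows "(\<lambda>z. real k * f z) \<in> trop_semifield G"
  using semifield_sum[of "{..<k}" "\<lambda>_. f" G] assms by simp

lemma semifield_of_int_mult:
  assumes "f \<in> trop_semifield G"
  shows "(\<lambda>z. real_of_int k * f z) \<in> trop_semifield G"
proof (cases k rule: int_cases2)
  case (nonneg m)
  then show ?thesis using semifield_of_nat_mult[OF assms, of m] by simp
next
  case (nonpos m)
  then show ?thesis
    using trop_semifield.minus[OF trop_semifield.const[of 0] semifield_of_nat_mult[OF assms, of m]]
    by simp
qed

lemma semifield_min:
  assumes "f \<in> trop_semifield G" "g \<in> trop_semifield G"
  shows "(\<lambda>z. min (f z) (g z)) \<in> trop_semifield G"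
proof -
  have "(\<lambda>z. min (f z) (g z)) = (\<lambda>z. (f z + g z) - max (f z) (g z))"
    by (auto simp: fun_eq_iff)
  then show ?thesis using assms by (auto intro: trop_semifield.intros)
qed

lemma semifield_abs:
  assumes "f \<in> trop_semifield G"
  shows "(\<lambda>z. \<bar>f z\<bar>) \<in> trop_semifield G"
proof -
  have "(\<lambda>z. \<bar>f z\<bar>) = (\<lambda>z. max (f z) (0 - f z))"
    by (auto simp: fun_eq_iff)
  also have "\<dots> \<in> trop_semifield G"
    by (intro trop_semifield.max trop_semifield.minus trop_semifield.const assms)
  finally show ?thesis .
qed

lemma semifield_Max:
  assumes "finite A" "A \<noteq> {}" "\<And>a. a \<in> A \<Longrightarrow> F a \<in> trop_semifield G"
  shows "(\<lambda>z. Max ((\<lambda>a. F a z) ` A)) \<in> trop_semifield G"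
  using assms by (induction A rule: finite_ne_induct) (auto intro: trop_semifield.max)

lemma semifield_Min:
  assumes "finite A" "A \<noteq> {}" "\<And>a. a \<in> A \<Longrightarrow> F a \<in> trop_semifield G"
  shows "(\<lambda>z. Min ((\<lambda>a. F a z) ` A)) \<in> trop_semifield G"
  using assms by (induction A rule: finite_ne_induct) (auto intro: semifield_min)

lemma trop_poly_const: "(\<lambda>_. \<gamma>) \<in> trop_poly I"
  unfolding trop_poly_def by (auto intro!: exI[of _ "{(\<gamma>, \<lambda>_. 0)}"])

lemma trop_poly_coord:
  assumes "finite I" "v \<in> I"
  shows "(\<lambda>z. z v) \<in> trop_poly I"
proof -
  have "(\<Sum>u\<in>I. real (if u = v then 1 else 0) * z u) = z v" for z :: "'a \<Rightarrow> real"
    using assms by (simp add: if_distrib if_distribR cong: if_cong)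
  then show ?thesis
    unfolding trop_poly_def by (auto intro!: exI[of _ "{(0, \<lambda>u. if u = v then 1 else 0)}"])
qed

lemma trop_poly_max:
  assumes "p \<in> trop_poly I" "q \<in> trop_poly I"
  shows "(\<lambda>z. max (p z) (q z)) \<in> trop_poly I"
proof -
  obtain T T' where T: "finite T" "T \<noteq> {}" "finite T'" "T' \<noteq> {}"
    and p: "p = (\<lambda>z. Max ((\<lambda>(\<gamma>, a). \<gamma> + (\<Sum>v\<in>I. real (a v) * z v)) ` T))"
    and q: "q = (\<lambda>z. Max ((\<lambda>(\<gamma>, a). \<gamma> + (\<Sum>v\<in>I. real (a v) * z v)) ` T'))"
    using assms unfolding trop_poly_def by blast
  show ?thesis
    unfolding trop_poly_def p q using T
    by (intro CollectI exI[of _ "T \<union> T'"]) (auto simp: image_Un Max_Un)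
qed

lemma trop_poly_plus:
  assumes "p \<in> trop_poly I" "q \<in> trop_poly I"
  shows "(\<lambda>z. p z + q z) \<in> trop_poly I"
proof -
  let ?e = "\<lambda>z (\<gamma>, a). \<gamma> + (\<Sum>v\<in>I. real (a v) * z v)"
  obtain T T' where T: "finite T" "T \<noteq> {}" "finite T'" "T' \<noteq> {}"
    and p: "p = (\<lambda>z. Max (?e z ` T))" and q: "q = (\<lambda>z. Max (?e z ` T'))"
    using assms unfolding trop_poly_def by blast
  let ?m = "\<lambda>((\<gamma>, a), (\<gamma>', a')). (\<gamma> + \<gamma>', \<lambda>v. a v + a' v)"
  have e: "?e z (?m (s, s')) = ?e z s + ?e z s'" for z s s'
    by (cases s; cases s') (auto simp: algebra_simps sum.distrib)
  have "Max (?e z ` T) + Max (?e z ` T') = Max (?e z ` (?m ` (T \<times> T')))" for z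
  proof (rule sym, rule Max_eqI)
    show "finite (?e z ` (?m ` (T \<times> T')))" using T by auto
    fix y assume "y \<in> ?e z ` (?m ` (T \<times> T'))"
    then obtain s s' where s: "s \<in> T" "s' \<in> T'" "y = ?e z (?m (s, s'))" by blast
    show "y \<le> Max (?e z ` T) + Max (?e z ` T')"
      unfolding s(3) e using s T by (intro add_mono Max_ge) auto
  next
    have "Max (?e z ` T) \<in> ?e z ` T" "Max (?e z ` T') \<in> ?e z ` T'"
      using T by (auto intro!: Max_in)
    then obtain s s' where s: "s \<in> T" "s' \<in> T'"
      "Max (?e z ` T) = ?e z s" "Max (?e z ` T') = ?e z s'" by blast
    then have "Max (?e z ` T) + Max (?e z ` T') = ?e z (?m (s, s'))" by (simp only: e)
    then show "Max (?e z ` T) + Max (?e z ` T') \<in> ?e z ` (?m ` (T \<times> T'))"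
      using s by blast
  qed
  then show ?thesis
    unfolding trop_poly_def p q using T
    by (intro CollectI exI[of _ "?m ` (T \<times> T')"]) auto
qed

lemma trop_ratI:
  assumes "p \<in> trop_poly I" "q \<in> trop_poly I"
  shows "(\<lambda>z. p z - q z) \<in> trop_rat I"
  using assms unfolding trop_rat_def by blast

lemma semifield_subset_trop_rat:
  assumes G: "G \<subseteq> trop_rat I"
  shows "trop_semifield G \<subseteq> trop_rat I"
proof
  fix f assume "f \<in> trop_semifield G"
  then show "f \<in> trop_rat I"
  proof induction
    case (gen f)
    then show ?case using G by blast
  next
    case (const \<gamma>)
    show ?case using trop_ratI[OF trop_poly_const[of \<gamma>] trop_poly_const[of 0]] by simp
  next
    case (max f g)
    then obtain p q p' q' where pq: "p \<in> trop_poly I" "q \<in> trop_poly I" "p' \<in> trop_poly I"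
      "q' \<in> trop_poly I" "f = (\<lambda>z. p z - q z)" "g = (\<lambda>z. p' z - q' z)"
      unfolding trop_rat_def by blast
    then have "(\<lambda>z. max (f z) (g z)) = (\<lambda>z. max (p z + q' z) (p' z + q z) - (q z + q' z))"
      by (auto simp: fun_eq_iff max_def)
    then show ?case
      by (simp add: trop_ratI trop_poly_plus trop_poly_max pq(1-4))
  next
    case (plus f g)
    then obtain p q p' q' where pq: "p \<in> trop_poly I" "q \<in> trop_poly I" "p' \<in> trop_poly I"
      "q' \<in> trop_poly I" "f = (\<lambda>z. p z - q z)" "g = (\<lambda>z. p' z - q' z)"
      unfolding trop_rat_def by blast
    then have "(\<lambda>z. f z + g z) = (\<lambda>z. (p z + p' z) - (q z + q' z))"
      by (auto simp: fun_eq_iff)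
    then show ?case
      by (simp add: trop_ratI trop_poly_plus pq(1-4))
  next
    case (minus f g)
    then obtain p q p' q' where pq: "p \<in> trop_poly I" "q \<in> trop_poly I" "p' \<in> trop_poly I"
      "q' \<in> trop_poly I" "f = (\<lambda>z. p z - q z)" "g = (\<lambda>z. p' z - q' z)"
      unfolding trop_rat_def by blast
    then have "(\<lambda>z. f z - g z) = (\<lambda>z. (p z + q' z) - (q z + p' z))"
      by (auto simp: fun_eq_iff)
    then show ?case
      by (simp add: trop_ratI trop_poly_plus pq(1-4))
  qed
qed

lemma semifield_coords_subset_trop_rat:
  assumes "finite I"
  shows "trop_semifield (coords I) \<subseteq> trop_rat I"
proof (rule semifield_subset_trop_rat, rule subsetI)
  fix f :: "('a \<Rightarrow> real) \<Rightarrow> real" assume "f \<in> coords I"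
  then obtain v where v: "v \<in> I" "f = (\<lambda>z. z v)" by blast
  show "f \<in> trop_rat I"
    using trop_ratI[OF trop_poly_coord[OF assms v(1)] trop_poly_const[of 0]] v(2) by simp
qed

text \<open>
  This lemma serves both to compose with tropical rational maps and to read a tropical rational
  function of the basic values as an expression in them.
\<close>

lemma trop_rat_subst:
  assumes f: "f \<in> trop_rat I" and h: "\<And>v. v \<in> I \<Longrightarrow> (\<lambda>x. h x v) \<in> trop_semifield G"
  shows "(\<lambda>x. f (h x)) \<in> trop_semifield G"
proof -
  have poly: "(\<lambda>x. p (h x)) \<in> trop_semifield G" if p: "p \<in> trop_poly I" for p
  proof -
    let ?e = "\<lambda>z (\<gamma>, a). \<gamma> + (\<Sum>v\<in>I. real (a v) * z v)"
    obtain T where T: "finite T" "T \<noteq> {}" "p = (\<lambda>z. Max (?e z ` T))"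
      using p unfolding trop_poly_def by blast
    have "(\<lambda>x. ?e (h x) s) \<in> trop_semifield G" for s
      by (cases s) (auto intro!: trop_semifield.plus trop_semifield.const semifield_sum
          semifield_of_nat_mult h)
    then show ?thesis
      unfolding T(3) using T(1,2) by (intro semifield_Max[of T "\<lambda>s x. ?e (h x) s"]) auto
  qed
  obtain p q where "p \<in> trop_poly I" "q \<in> trop_poly I" "f = (\<lambda>z. p z - q z)"
    using f unfolding trop_rat_def by blast
  then show ?thesis using trop_semifield.minus[OF poly poly, of p q] by simp
qed

lemma trop_rat_eq_semifield:
  assumes "finite I"
  shows "trop_rat I = trop_semifield (coords I)"
proof
  show "trop_rat I \<subseteq> trop_semifield (coords I)"
    using trop_rat_subst[of _ I "\<lambda>z. z" "coords I"] by (auto intro: trop_semifield.gen)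
qed (rule semifield_coords_subset_trop_rat[OF assms])

text \<open>
  The constant of a maximum or of a sum is bounded by the sum of the two constants, so induction
  over semifield expressions in the coordinates produces a Lipschitz constant for the sup-norm.
\<close>

lemma trop_rat_Lipschitz:
  fixes f :: "('v \<Rightarrow> real) \<Rightarrow> real"
  assumes I: "finite I" and f: "f \<in> trop_rat I"
  obtains L where "0 \<le> L"
    "\<And>z z' e. 0 \<le> e \<Longrightarrow> (\<And>v. v \<in> I \<Longrightarrow> \<bar>z v - z' v\<bar> \<le> e) \<Longrightarrow> \<bar>f z - f z'\<bar> \<le> L * e"
proof -
  define lip where "lip f L \<longleftrightarrow> (\<forall>z z' e. 0 \<le> e \<longrightarrow> (\<forall>v\<in>I. \<bar>z v - z' v\<bar> \<le> e) \<longrightarrow> \<bar>f z - f z'\<bar> \<le> L * e)"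
    for f :: "('v \<Rightarrow> real) \<Rightarrow> real" and L
  have "f \<in> trop_semifield (coords I)" using f trop_rat_eq_semifield[OF I] by blast
  then have "\<exists>L\<ge>0. lip f L"
  proof induction
    case (gen f)
    then show ?case by (intro exI[of _ 1]) (auto simp: lip_def)
  next
    case (const \<gamma>)
    then show ?case by (intro exI[of _ 0]) (auto simp: lip_def)
  next
    case (max f g)
    then obtain K L where KL: "K \<ge> 0" "L \<ge> 0" "lip f K" "lip g L" by blast
    have "lip (\<lambda>z. max (f z) (g z)) (K + L)"
    unfolding lip_def
    proof (intro allI impI)
      fix z z' :: "'v \<Rightarrow> real" and e :: real assume e: "0 \<le> e" "\<forall>v\<in>I. \<bar>z v - z' v\<bar> \<le> e"
      have "\<bar>f z - f z'\<bar> \<le> K * e" "\<bar>g z - g z'\<bar> \<le> L * e" "0 \<le> K * e" "0 \<le> L * e"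
        using KL e unfolding lip_def by simp_all
      then show "\<bar>max (f z) (g z) - max (f z') (g z')\<bar> \<le> (K + L) * e"
        unfolding distrib_right by linarith
    qed
    then show ?case using KL by (intro exI[of _ "K + L"]) auto
  next
    case (plus f g)
    then obtain K L where KL: "K \<ge> 0" "L \<ge> 0" "lip f K" "lip g L" by blast
    have "lip (\<lambda>z. f z + g z) (K + L)"
    unfolding lip_def
    proof (intro allI impI)
      fix z z' :: "'v \<Rightarrow> real" and e :: real assume e: "0 \<le> e" "\<forall>v\<in>I. \<bar>z v - z' v\<bar> \<le> e"
      have "\<bar>f z - f z'\<bar> \<le> K * e" "\<bar>g z - g z'\<bar> \<le> L * e" using KL e unfolding lip_def by simp_all
      then show "\<bar>f z + g z - (f z' + g z')\<bar> \<le> (K + L) * e"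
        unfolding distrib_right by linarith
    qed
    then show ?case using KL by (intro exI[of _ "K + L"]) auto
  next
    case (minus f g)
    then obtain K L where KL: "K \<ge> 0" "L \<ge> 0" "lip f K" "lip g L" by blast
    have "lip (\<lambda>z. f z - g z) (K + L)"
    unfolding lip_def
    proof (intro allI impI)
      fix z z' :: "'v \<Rightarrow> real" and e :: real assume e: "0 \<le> e" "\<forall>v\<in>I. \<bar>z v - z' v\<bar> \<le> e"
      have "\<bar>f z - f z'\<bar> \<le> K * e" "\<bar>g z - g z'\<bar> \<le> L * e" using KL e unfolding lip_def by simp_all
      then show "\<bar>f z - g z - (f z' - g z')\<bar> \<le> (K + L) * e"
        unfolding distrib_right by linarith
    qed
    then show ?case using KL by (intro exI[of _ "K + L"]) auto
  qed
  then show ?thesis using that unfolding lip_def by blast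
qed

lemma trop_rat_cong:
  assumes "finite I" "f \<in> trop_rat I" "\<And>v. v \<in> I \<Longrightarrow> z v = z' v"
  shows "f z = f z'"
proof (rule trop_rat_Lipschitz[OF assms(1,2)])
  fix L assume "\<And>z z' e. 0 \<le> e \<Longrightarrow> (\<And>v. v \<in> I \<Longrightarrow> \<bar>z v - z' v\<bar> \<le> e) \<Longrightarrow> \<bar>f z - f z'\<bar> \<le> L * e"
  from this[of 0 z z'] show ?thesis using assms(3) by simp
qed

section \<open>Basic values\<close>

text \<open>
  The families over which a basic value is a maximum are unconstrained outside \<open>{1..r}\<close>, hence
  infinite in number; restricting them to \<open>{1..r}\<close> makes the index set of the maximum finite.
\<close>

definition packings :: "nat \<Rightarrow> nat \<Rightarrow> (nat \<Rightarrow> nat) \<Rightarrow> (nat \<Rightarrow> nat set) set" where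
  "packings n r c = {S \<in> {1..r} \<rightarrow>\<^sub>E Pow {1..n}.
     disjoint_family_on S {1..r} \<and> (\<forall>\<alpha>\<in>{1..r}. card (S \<alpha>) = c \<alpha>)}"

lemma finite_packings: "finite (packings n r c)"
proof (rule finite_subset)
  show "packings n r c \<subseteq> {1..r} \<rightarrow>\<^sub>E Pow {1..n}" unfolding packings_def by blast
  show "finite ({1..r} \<rightarrow>\<^sub>E Pow {1..n})" by (intro finite_PiE) auto
qed

lemma basic_eq_Max_packings:
  "basic n r c M = Max ((\<lambda>S. \<Sum>\<alpha>=1..r. \<Sum>i\<in>S \<alpha>. M (i, \<alpha>)) ` packings n r c)"
proof -
  let ?e = "\<lambda>S. \<Sum>\<alpha>=1..r. \<Sum>i\<in>S \<alpha>. M (i, \<alpha>)"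
  let ?P = "\<lambda>S. disjoint_family_on S {1..r} \<and>
    (\<forall>\<alpha>\<in>{1..r}. S \<alpha> \<subseteq> {1..n} \<and> card (S \<alpha>) = c \<alpha>)"
  have "{?e S | S. ?P S} = ?e ` packings n r c"
  proof
    show "?e ` packings n r c \<subseteq> {?e S | S. ?P S}"
      unfolding packings_def by (fastforce simp: PiE_iff)
    show "{?e S | S. ?P S} \<subseteq> ?e ` packings n r c"
    proof
      fix y assume "y \<in> {?e S | S. ?P S}"
      then obtain S where S: "y = ?e S" "?P S" by blast
      have "restrict S {1..r} \<in> packings n r c"
        using S(2) unfolding packings_def disjoint_family_on_def by auto
      moreover have "?e (restrict S {1..r}) = ?e S" by (intro sum.cong) auto
      ultimately show "y \<in> ?e ` packings n r c" using S(1) by (intro image_eqI[of _ _ "restrict S {1..r}"]) simp_all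
    qed
  qed
  then show ?thesis unfolding basic_def by simp
qed

lemma le_basic:
  assumes "disjoint_family_on S {1..r}"
    and "\<And>\<alpha>. \<alpha> \<in> {1..r} \<Longrightarrow> S \<alpha> \<subseteq> {1..n}" "\<And>\<alpha>. \<alpha> \<in> {1..r} \<Longrightarrow> card (S \<alpha>) = c \<alpha>"
  shows "(\<Sum>\<alpha>=1..r. \<Sum>i\<in>S \<alpha>. M (i, \<alpha>)) \<le> basic n r c M"
proof -
  have "restrict S {1..r} \<in> packings n r c"
    using assms unfolding packings_def disjoint_family_on_def by auto
  then have "(\<Sum>\<alpha>=1..r. \<Sum>i\<in>restrict S {1..r} \<alpha>. M (i, \<alpha>)) \<le> basic n r c M"
    unfolding basic_eq_Max_packings by (intro Max_ge finite_imageI finite_packings imageI)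
  then show ?thesis by simp
qed

lemma exists_disjoint_family:
  assumes "finite J" "finite X" "(\<Sum>\<alpha>\<in>J. c \<alpha>) \<le> card X"
  shows "\<exists>S. disjoint_family_on S J \<and> (\<forall>\<alpha>\<in>J. S \<alpha> \<subseteq> X \<and> card (S \<alpha>) = c \<alpha>)"
  using assms(1,3)
proof induction
  case empty
  then show ?case by (auto simp: disjoint_family_on_def)
next
  case (insert \<beta> J)
  then obtain S where S: "disjoint_family_on S J" "\<And>\<alpha>. \<alpha> \<in> J \<Longrightarrow> S \<alpha> \<subseteq> X"
    "\<And>\<alpha>. \<alpha> \<in> J \<Longrightarrow> card (S \<alpha>) = c \<alpha>" by auto
  have U: "(\<Union>\<alpha>\<in>J. S \<alpha>) \<subseteq> X" using S(2) by blast
  have "card (\<Union>\<alpha>\<in>J. S \<alpha>) \<le> (\<Sum>\<alpha>\<in>J. c \<alpha>)"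
    using card_UN_le[OF insert(1), of S] S(3) by simp
  then have "c \<beta> \<le> card (X - (\<Union>\<alpha>\<in>J. S \<alpha>))"
    using insert(1,2,4) U assms(2) by (simp add: card_Diff_subset finite_subset)
  then obtain Y where Y: "Y \<subseteq> X - (\<Union>\<alpha>\<in>J. S \<alpha>)" "card Y = c \<beta>"
    by (meson obtain_subset_with_card_n)
  show ?case
  proof (intro exI[of _ "S(\<beta> := Y)"] conjI ballI)
    show "disjoint_family_on (S(\<beta> := Y)) (insert \<beta> J)"
      unfolding disjoint_family_on_def
    proof (intro ballI impI)
      fix \<alpha> \<gamma> assume "\<alpha> \<in> insert \<beta> J" "\<gamma> \<in> insert \<beta> J" "\<alpha> \<noteq> \<gamma>"
      then show "(S(\<beta> := Y)) \<alpha> \<inter> (S(\<beta> := Y)) \<gamma> = {}"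
        using disjoint_family_onD[OF S(1), of \<alpha> \<gamma>] Y(1) by (cases "\<alpha> = \<beta>"; cases "\<gamma> = \<beta>") auto
    qed
  qed (use S Y insert(2) in auto)
qed

lemma packings_nonempty:
  assumes "(\<Sum>\<alpha>=1..r. c \<alpha>) \<le> n"
  shows "packings n r c \<noteq> {}"
proof -
  obtain S where "disjoint_family_on S {1..r}" "\<forall>\<alpha>\<in>{1..r}. S \<alpha> \<subseteq> {1..n} \<and> card (S \<alpha>) = c \<alpha>"
    using exists_disjoint_family[of "{1..r}" "{1..n}" c] assms by auto
  then have "restrict S {1..r} \<in> packings n r c"
    unfolding packings_def disjoint_family_on_def by auto
  then show ?thesis by blast
qed

lemma basic_attained:
  assumes "(\<Sum>\<alpha>=1..r. c \<alpha>) \<le> n"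
  obtains S where "disjoint_family_on S {1..r}" "\<And>\<alpha>. \<alpha> \<in> {1..r} \<Longrightarrow> S \<alpha> \<subseteq> {1..n}"
    "\<And>\<alpha>. \<alpha> \<in> {1..r} \<Longrightarrow> card (S \<alpha>) = c \<alpha>"
    "basic n r c M = (\<Sum>\<alpha>=1..r. \<Sum>i\<in>S \<alpha>. M (i, \<alpha>))"
proof -
  have "basic n r c M \<in> (\<lambda>S. \<Sum>\<alpha>=1..r. \<Sum>i\<in>S \<alpha>. M (i, \<alpha>)) ` packings n r c"
    unfolding basic_eq_Max_packings
    using packings_nonempty[OF assms] by (intro Max_in) (auto simp: finite_packings)
  then obtain S where S: "S \<in> packings n r c"
    "basic n r c M = (\<Sum>\<alpha>=1..r. \<Sum>i\<in>S \<alpha>. M (i, \<alpha>))" by blast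
  show ?thesis
    by (rule that[of S]) (use S in \<open>auto simp: packings_def PiE_iff\<close>)
qed

lemma finite_mat_idx: "finite (mat_idx n r)"
  unfolding mat_idx_def by simp

lemma finite_exp_idx: "finite (exp_idx n r)"
proof (rule finite_subset)
  show "exp_idx n r \<subseteq> {c. \<forall>\<alpha>. (\<alpha> \<in> {1..r} \<longrightarrow> c \<alpha> \<in> {0..n}) \<and> (\<alpha> \<notin> {1..r} \<longrightarrow> c \<alpha> = 0)}"
  proof (clarify, intro conjI impI)
    fix c \<alpha> assume c: "c \<in> exp_idx n r"
    show "c \<alpha> \<in> {0..n}" if "\<alpha> \<in> {1..r}"
      using member_le_sum[OF that, of c] c unfolding exp_idx_def by auto
    show "c \<alpha> = 0" if "\<alpha> \<notin> {1..r}" using c that unfolding exp_idx_def by blast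
  qed
qed (rule finite_set_of_finite_funs; simp)

lemma basic_semifield_coords:
  assumes "c \<in> exp_idx n r"
  shows "basic n r c \<in> trop_semifield (coords (mat_idx n r))"
proof -
  have "(\<lambda>M. Max ((\<lambda>S. \<Sum>\<alpha>=1..r. \<Sum>i\<in>S \<alpha>. M (i, \<alpha>)) ` packings n r c))
      \<in> trop_semifield (coords (mat_idx n r))"
  proof (rule semifield_Max[OF finite_packings packings_nonempty])
    show "(\<Sum>\<alpha>=1..r. c \<alpha>) \<le> n" using assms unfolding exp_idx_def by blast
    fix S assume S: "S \<in> packings n r c"
    show "(\<lambda>M. \<Sum>\<alpha>=1..r. \<Sum>i\<in>S \<alpha>. M (i, \<alpha>)) \<in> trop_semifield (coords (mat_idx n r))"
    proof (intro semifield_sum trop_semifield.gen)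
      fix \<alpha> i assume "\<alpha> \<in> {1..r}" "i \<in> S \<alpha>"
      moreover from this have "S \<alpha> \<subseteq> {1..n}" using S unfolding packings_def by (auto simp: PiE_iff)
      ultimately have "(i, \<alpha>) \<in> mat_idx n r" unfolding mat_idx_def by auto
      then show "(\<lambda>M. M (i, \<alpha>)) \<in> coords (mat_idx n r)" by blast
    qed
  qed
  then show ?thesis by (simp add: basic_eq_Max_packings[abs_def])
qed

lemma basic_permute_rows:
  assumes \<pi>: "\<pi> permutes {1..n}" and c: "c \<in> exp_idx n r"
  shows "basic n r c (permute_rows \<pi> M) = basic n r c M"
proof -
  \<comment> \<open>One inequality for all permutations suffices, since it also applies to the inverse.\<close>
  have le: "basic n r c (permute_rows \<rho> N) \<le> basic n r c N" if \<rho>: "\<rho> permutes {1..n}" for \<rho> N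
  proof -
    have inj: "inj \<rho>" using \<rho> by (rule permutes_inj)
    obtain S where S: "disjoint_family_on S {1..r}" "\<And>\<alpha>. \<alpha> \<in> {1..r} \<Longrightarrow> S \<alpha> \<subseteq> {1..n}"
      "\<And>\<alpha>. \<alpha> \<in> {1..r} \<Longrightarrow> card (S \<alpha>) = c \<alpha>"
      "basic n r c (permute_rows \<rho> N) = (\<Sum>\<alpha>=1..r. \<Sum>i\<in>S \<alpha>. permute_rows \<rho> N (i, \<alpha>))"
      using basic_attained[of c r n] c unfolding exp_idx_def by blast
    have "basic n r c (permute_rows \<rho> N) = (\<Sum>\<alpha>=1..r. \<Sum>i\<in>\<rho> ` S \<alpha>. N (i, \<alpha>))"
      unfolding S(4) by (simp add: permute_rows_def sum.reindex permutes_inj_on[OF \<rho>])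
    also have "\<dots> \<le> basic n r c N"
    proof (rule le_basic)
      show "disjoint_family_on (\<lambda>\<alpha>. \<rho> ` S \<alpha>) {1..r}"
        using S(1) inj unfolding disjoint_family_on_def by (auto dest: injD)
      show "\<rho> ` S \<alpha> \<subseteq> {1..n}" if "\<alpha> \<in> {1..r}" for \<alpha>
        using S(2)[OF that] permutes_image[OF \<rho>] by blast
      show "card (\<rho> ` S \<alpha>) = c \<alpha>" if "\<alpha> \<in> {1..r}" for \<alpha>
        using S(3)[OF that] by (simp add: card_image permutes_inj_on[OF \<rho>])
    qed
    finally show ?thesis .
  qed
  have "permute_rows (inv \<pi>) (permute_rows \<pi> M) = M"
    unfolding permute_rows_def using permutes_inverses[OF \<pi>] by (auto simp: fun_eq_iff)
  then have "basic n r c M \<le> basic n r c (permute_rows \<pi> M)"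
    using le[OF permutes_inv[OF \<pi>], of "permute_rows \<pi> M"] by simp
  then show ?thesis using le[OF \<pi>] by (simp add: antisym)
qed

section \<open>The bump attached to a row\<close>

text \<open>
  \<open>spread r (\<lambda>\<beta>. u \<beta> - v \<beta>)\<close> is the tropical (Hilbert projective) distance of \<open>u\<close> and \<open>v\<close>: it
  does not change when a constant is added to all coordinates \<open>0, \<dots>, r\<close> of one of them.
\<close>

definition spread :: "nat \<Rightarrow> (nat \<Rightarrow> real) \<Rightarrow> real" where
  "spread r t = Max (t ` {0..r}) - Min (t ` {0..r})"

lemma le_spread: "\<alpha> \<le> r \<Longrightarrow> \<beta> \<le> r \<Longrightarrow> t \<alpha> - t \<beta> \<le> spread r t"
  unfolding spread_def by (intro diff_mono Max_ge Min_le) auto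

lemma spread_attained:
  obtains \<alpha> \<beta> where "\<alpha> \<le> r" "\<beta> \<le> r" "spread r t = t \<alpha> - t \<beta>"
proof -
  have "Max (t ` {0..r}) \<in> t ` {0..r}" "Min (t ` {0..r}) \<in> t ` {0..r}"
    by (intro Max_in Min_in; simp)+
  then show ?thesis using that unfolding spread_def by fastforce
qed

lemma spread_nonneg: "0 \<le> spread r t"
  using le_spread[of 0 r 0 t] by simp

lemma spread_triangle: "spread r (\<lambda>\<beta>. u \<beta> - x \<beta>) \<le> spread r (\<lambda>\<beta>. u \<beta> - v \<beta>) + spread r (\<lambda>\<beta>. v \<beta> - x \<beta>)"
proof -
  obtain \<alpha> \<beta> where *: "\<alpha> \<le> r" "\<beta> \<le> r" "spread r (\<lambda>\<beta>. u \<beta> - x \<beta>) = (u \<alpha> - x \<alpha>) - (u \<beta> - x \<beta>)"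
    using spread_attained by blast
  show ?thesis
    using *(3) le_spread[OF *(1,2), of "\<lambda>\<beta>. u \<beta> - v \<beta>"] le_spread[OF *(1,2), of "\<lambda>\<beta>. v \<beta> - x \<beta>"] by linarith
qed

lemma spread_commute: "spread r (\<lambda>\<beta>. u \<beta> - x \<beta>) = spread r (\<lambda>\<beta>. x \<beta> - u \<beta>)"
proof -
  have "spread r (\<lambda>\<beta>. u \<beta> - x \<beta>) \<le> spread r (\<lambda>\<beta>. x \<beta> - u \<beta>)" for u x
  proof -
    obtain \<alpha> \<beta> where *: "\<alpha> \<le> r" "\<beta> \<le> r" "spread r (\<lambda>\<beta>. u \<beta> - x \<beta>) = (u \<alpha> - x \<alpha>) - (u \<beta> - x \<beta>)"
      using spread_attained by blast
    show ?thesis using *(3) le_spread[OF *(2,1), of "\<lambda>\<beta>. x \<beta> - u \<beta>"] by linarith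
  qed
  then show ?thesis by (intro antisym)
qed

text \<open>
  Both sides measure intervals: \<open>max 0 (b - a)\<close> is the length of \<open>[a, b]\<close>. With
  \<open>b = m + \<delta>\<close>, the part of \<open>[max s M, b]\<close> above \<open>u\<close> minus the part above \<open>u + \<delta>\<close> is the part
  between \<open>u\<close> and \<open>u + \<delta>\<close>.
\<close>

lemma overlap_difference:
  fixes u m M s \<delta> :: real
  assumes "0 \<le> \<delta>"
  shows "max 0 (m + \<delta> - max (max s u) M) - max 0 (m + \<delta> - max (max s (u + \<delta>)) M)
    = max 0 (min u m + \<delta> - max s (max u M))"
  using assms by linarith

text \<open>
  The additional argument \<open>s\<close> of the maximum makes an induction over the set of differenced
  coordinates possible: taking the difference in one more coordinate \<open>\<beta>\<close> replaces \<open>s\<close> by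
  \<open>max s (t \<beta>)\<close> and by \<open>max s (t \<beta> + \<delta>)\<close>, with opposite signs.
\<close>

lemma mixed_difference_Max_aux:
  fixes t :: "'b \<Rightarrow> real"
  assumes "finite J" "J \<noteq> {}" "0 \<le> \<delta>"
  shows "(\<Sum>A\<in>Pow J. (-1) ^ card A * Max (insert s ((\<lambda>\<beta>. t \<beta> + (if \<beta> \<in> A then \<delta> else 0)) ` J)))
    = - max 0 (Min (t ` J) + \<delta> - Max (insert s (t ` J)))"
  using assms(1,2)
proof (induction J arbitrary: s rule: finite_ne_induct)
  case (singleton \<beta>)
  then show ?case using assms(3) by (simp add: Pow_insert max_def)
next
  case (insert \<beta> J)
  let ?F = "\<lambda>J s A. (-1) ^ card A * Max (insert s ((\<lambda>\<beta>. t \<beta> + (if \<beta> \<in> A then \<delta> else 0)) ` J))"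
  let ?E = "\<lambda>s. - max 0 (Min (t ` J) + \<delta> - Max (insert s (t ` J)))"
  have inj: "inj_on (insert \<beta>) (Pow J)"
    using insert(3) by (intro inj_onI) (metis PowD insert_ident subsetD)
  have disj: "Pow J \<inter> insert \<beta> ` Pow J = {}" using insert(3) by blast
  have out: "?F (insert \<beta> J) s A = ?F J (max s (t \<beta>)) A" if "A \<in> Pow J" for A
  proof -
    have "\<beta> \<notin> A" using that insert(3) by blast
    then show ?thesis using insert(1) insert(2) by (simp add: max.assoc)
  qed
  have inn: "?F (insert \<beta> J) s (insert \<beta> A) = - ?F J (max s (t \<beta> + \<delta>)) A" if "A \<in> Pow J" for A
  proof -
    have A: "\<beta> \<notin> A" "finite A" using that insert(1,3) finite_subset by blast+
    have "(\<lambda>\<gamma>. t \<gamma> + (if \<gamma> \<in> insert \<beta> A then \<delta> else 0)) ` J = (\<lambda>\<gamma>. t \<gamma> + (if \<gamma> \<in> A then \<delta> else 0)) ` J"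
      using insert(3) by (intro image_cong) auto
    then show ?thesis using A insert(1) insert(2) by (simp add: max.assoc)
  qed
  have "(\<Sum>A\<in>Pow (insert \<beta> J). ?F (insert \<beta> J) s A)
      = (\<Sum>A\<in>Pow J. ?F (insert \<beta> J) s A) + (\<Sum>A\<in>Pow J. ?F (insert \<beta> J) s (insert \<beta> A))"
    unfolding Pow_insert using insert(1) disj inj
    by (simp add: sum.union_disjoint sum.reindex)
  also have "\<dots> = (\<Sum>A\<in>Pow J. ?F J (max s (t \<beta>)) A) - (\<Sum>A\<in>Pow J. ?F J (max s (t \<beta> + \<delta>)) A)"
    using sum.cong[OF refl out, of "Pow J"] sum.cong[OF refl inn, of "Pow J"]
    by (simp add: sum_negf)
  also have "\<dots> = ?E (max s (t \<beta>)) - ?E (max s (t \<beta> + \<delta>))"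
    by (simp only: insert.IH)
  also have "\<dots> = - max 0 (Min (t ` insert \<beta> J) + \<delta> - Max (insert s (t ` insert \<beta> J)))"
    using insert(1,2) overlap_difference[OF assms(3), of "Min (t ` J)" s "t \<beta>" "Max (t ` J)"]
    by simp
  finally show ?case .
qed

text \<open>
  The mixed difference of the maximum in all coordinates vanishes as soon as the coordinates of \<open>t\<close>
  spread over at least \<open>\<delta>\<close>, for then raising the smallest one by \<open>\<delta>\<close> never changes the maximum.
  So it is a bump around the diagonal.
\<close>

lemma mixed_difference_Max:
  assumes "0 \<le> \<delta>"
  shows "(\<Sum>A\<in>Pow {0..r}. (-1) ^ card A * Max ((\<lambda>\<beta>. t \<beta> + (if \<beta> \<in> A then \<delta> else 0)) ` {0..r}))
    = - max 0 (\<delta> - spread r t)"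
proof -
  \<comment> \<open>The auxiliary argument \<open>s = Min t\<close> is too small to affect any of the maxima.\<close>
  have ins: "Max (insert (Min (t ` {0..r})) ((\<lambda>\<beta>. t \<beta> + (if \<beta> \<in> A then \<delta> else 0)) ` {0..r}))
      = Max ((\<lambda>\<beta>. t \<beta> + (if \<beta> \<in> A then \<delta> else 0)) ` {0..r})" for A
  proof -
    have "Min (t ` {0..r}) \<le> t 0" by (intro Min_le) auto
    also have "\<dots> \<le> t 0 + (if 0 \<in> A then \<delta> else 0)" using assms by simp
    also have "\<dots> \<le> Max ((\<lambda>\<beta>. t \<beta> + (if \<beta> \<in> A then \<delta> else 0)) ` {0..r})" by (intro Max_ge) auto
    finally show ?thesis by (simp add: max_absorb2)
  qed
  have "Max (insert (Min (t ` {0..r})) (t ` {0..r})) = Max (t ` {0..r})"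
    using ins[of "{}"] by simp
  then show ?thesis
    using mixed_difference_Max_aux[of "{0..r}" \<delta> "Min (t ` {0..r})" t] assms
    by (simp add: ins spread_def algebra_simps)
qed

section \<open>Matching the rows of two matrices\<close>

text \<open>
  The entry \<open>0\<close> in position \<open>0\<close> stands for the option of leaving a row out of all the sets whose
  sizes are prescribed by an exponent. It also turns \<open>spread\<close> into a genuine metric on rows.
\<close>

definition row :: "rmat \<Rightarrow> nat \<Rightarrow> nat \<Rightarrow> real" where
  "row M i = (\<lambda>\<beta>. if \<beta> = 0 then 0 else M (i, \<beta>))"

lemma sum_card_fibres:
  fixes d :: "nat \<Rightarrow> nat"
  assumes "\<And>i. i \<in> {1..n} \<Longrightarrow> d i \<in> {0..r}"
  shows "(\<Sum>\<beta>=0..r. card {i \<in> {1..n}. d i = \<beta>}) = n"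
proof -
  have "d ` {1..n} \<subseteq> {0..r}" using assms by blast
  from sum.group[OF _ _ this, of "\<lambda>_. 1 :: nat"] show ?thesis by simp
qed

lemma sum_row_choice:
  assumes "\<And>i. i \<in> {1..n} \<Longrightarrow> d i \<in> {0..r}"
  shows "(\<Sum>i=1..n. t (d i) + row M i (d i))
    = real (card {i \<in> {1..n}. d i = 0}) * t 0
      + (\<Sum>\<alpha>=1..r. real (card {i \<in> {1..n}. d i = \<alpha>}) * t \<alpha>)
      + (\<Sum>\<alpha>=1..r. \<Sum>i\<in>{i \<in> {1..n}. d i = \<alpha>}. M (i, \<alpha>))"
proof -
  have "(\<Sum>i=1..n. t (d i) + row M i (d i))
      = (\<Sum>\<beta>=0..r. \<Sum>i\<in>{i \<in> {1..n}. d i = \<beta>}. t (d i) + row M i (d i))"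
    by (rule sum.group[symmetric]) (use assms in auto)
  also have "\<dots> = (\<Sum>\<beta>=0..r. \<Sum>i\<in>{i \<in> {1..n}. d i = \<beta>}. t \<beta> + row M i \<beta>)"
    by (intro sum.cong) auto
  finally show ?thesis
    by (simp add: sum.atLeast_Suc_atMost sum.distrib row_def)
qed

text \<open>
  The sum of row maxima is the maximum over all exponents \<open>c\<close> with \<open>\<bar>c\<bar> \<le> n\<close> of the basic value of
  \<open>c\<close> plus a term that depends on \<open>c\<close>, \<open>n\<close> and \<open>t\<close> only: a choice of a column for every row, with
  \<open>0\<close> for none, is the same as a family of disjoint row sets. Hence the sums for two matrices are
  as close as their basic values.
\<close>

lemma sum_row_Max_le:
  assumes "0 \<le> \<epsilon>" and close: "\<And>c. c \<in> exp_idx n r \<Longrightarrow> basic n r c M \<le> basic n r c N + \<epsilon>"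
  shows "(\<Sum>i=1..n. Max ((\<lambda>\<beta>. t \<beta> + row M i \<beta>) ` {0..r}))
    \<le> (\<Sum>i=1..n. Max ((\<lambda>\<beta>. t \<beta> + row N i \<beta>) ` {0..r})) + \<epsilon>"
proof -
  have "\<exists>\<beta>\<in>{0..r}. Max ((\<lambda>\<beta>. t \<beta> + row M i \<beta>) ` {0..r}) = t \<beta> + row M i \<beta>" for i
  proof -
    have "Max ((\<lambda>\<beta>. t \<beta> + row M i \<beta>) ` {0..r}) \<in> (\<lambda>\<beta>. t \<beta> + row M i \<beta>) ` {0..r}"
      by (intro Max_in) auto
    then show ?thesis by blast
  qed
  \<comment> \<open>An optimal choice \<open>a\<close> for \<open>M\<close> determines disjoint sets \<open>S\<close> of sizes \<open>c\<close>.\<close>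
  then obtain a where a: "\<And>i. a i \<in> {0..r}"
    "\<And>i. Max ((\<lambda>\<beta>. t \<beta> + row M i \<beta>) ` {0..r}) = t (a i) + row M i (a i)"
    by metis
  define S where "S \<beta> = {i \<in> {1..n}. a i = \<beta>}" for \<beta>
  define c where "c \<alpha> = (if \<alpha> \<in> {1..r} then card (S \<alpha>) else 0)" for \<alpha>
  have finS: "finite (S \<beta>)" for \<beta> unfolding S_def by simp
  have disjS: "disjoint_family_on S {1..r}" unfolding disjoint_family_on_def S_def by auto
  have "(\<Sum>\<beta>=0..r. card (S \<beta>)) = n"
    unfolding S_def using sum_card_fibres a(1) by blast
  then have n0: "card (S 0) + (\<Sum>\<alpha>=1..r. c \<alpha>) = n"
    by (simp add: sum.atLeast_Suc_atMost c_def)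
  have bM: "(\<Sum>\<alpha>=1..r. \<Sum>i\<in>S \<alpha>. M (i, \<alpha>)) \<le> (\<Sum>\<alpha>=1..r. \<Sum>i\<in>T \<alpha>. N (i, \<alpha>)) + \<epsilon>"
    if "c \<in> exp_idx n r" "basic n r c N = (\<Sum>\<alpha>=1..r. \<Sum>i\<in>T \<alpha>. N (i, \<alpha>))" for T
  proof -
    have "(\<Sum>\<alpha>=1..r. \<Sum>i\<in>S \<alpha>. M (i, \<alpha>)) \<le> basic n r c M"
      by (rule le_basic[OF disjS]) (auto simp: S_def c_def)
    then show ?thesis using close[OF that(1)] that(2) by simp
  qed
  have "(\<Sum>\<alpha>=1..r. c \<alpha>) \<le> n" using n0 by linarith
  from basic_attained[OF this, of N] obtain T where T: "disjoint_family_on T {1..r}" "\<And>\<alpha>. \<alpha> \<in> {1..r} \<Longrightarrow> T \<alpha> \<subseteq> {1..n}"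
      "\<And>\<alpha>. \<alpha> \<in> {1..r} \<Longrightarrow> card (T \<alpha>) = c \<alpha>"
      "basic n r c N = (\<Sum>\<alpha>=1..r. \<Sum>i\<in>T \<alpha>. N (i, \<alpha>))" by blast
  have MN: "(\<Sum>\<alpha>=1..r. \<Sum>i\<in>S \<alpha>. M (i, \<alpha>)) \<le> (\<Sum>\<alpha>=1..r. \<Sum>i\<in>T \<alpha>. N (i, \<alpha>)) + \<epsilon>"
  proof (cases "(\<Sum>\<alpha>=1..r. c \<alpha>) = 0")
    case True
    then have c0: "\<And>\<alpha>. \<alpha> \<in> {1..r} \<Longrightarrow> c \<alpha> = 0" by auto
    have "S \<alpha> = {} \<and> T \<alpha> = {}" if "\<alpha> \<in> {1..r}" for \<alpha>
    proof -
      have "finite (T \<alpha>)" using T(2)[OF that] finite_subset by blast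
      moreover have "card (T \<alpha>) = 0" using T(3) c0 that by simp
      moreover have "card (S \<alpha>) = 0" using c0[OF that] that by (simp add: c_def)
      ultimately show ?thesis using finS by simp
    qed
    then show ?thesis using assms(1) by simp
  next
    case False
    then have "0 < (\<Sum>\<alpha>=1..r. c \<alpha>)" by blast
    moreover have "\<forall>\<alpha>. \<alpha> \<notin> {1..r} \<longrightarrow> c \<alpha> = 0" by (simp add: c_def)
    ultimately have "c \<in> exp_idx n r"
      using \<open>(\<Sum>\<alpha>=1..r. c \<alpha>) \<le> n\<close> unfolding exp_idx_def by blast
    then show ?thesis using bM T(4) by blast
  qed
  \<comment> \<open>The sets \<open>T\<close>, optimal for \<open>N\<close> and of the same sizes \<open>c\<close>, give back a choice \<open>b\<close> for \<open>N\<close>.\<close>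
  define b where "b i = (if \<exists>\<alpha>\<in>{1..r}. i \<in> T \<alpha> then SOME \<alpha>. \<alpha> \<in> {1..r} \<and> i \<in> T \<alpha> else 0)" for i
  have b_T: "b i = \<alpha>" if "\<alpha> \<in> {1..r}" "i \<in> T \<alpha>" for i \<alpha>
  proof -
    have "b i \<in> {1..r} \<and> i \<in> T (b i)"
      unfolding b_def using that someI_ex[of "\<lambda>\<alpha>. \<alpha> \<in> {1..r} \<and> i \<in> T \<alpha>"] by auto
    then show ?thesis using T(1) that unfolding disjoint_family_on_def by blast
  qed
  have b_r: "b i \<in> {0..r}" for i
  proof (cases "\<exists>\<alpha>\<in>{1..r}. i \<in> T \<alpha>")
    case True
    then obtain \<alpha> where "\<alpha> \<in> {1..r}" "i \<in> T \<alpha>" by blast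
    then show ?thesis using b_T by simp
  next
    case False
    then have "b i = 0" unfolding b_def by (rule if_not_P)
    then show ?thesis by simp
  qed
  have Tb: "{i \<in> {1..n}. b i = \<alpha>} = T \<alpha>" if "\<alpha> \<in> {1..r}" for \<alpha>
  proof
    show "T \<alpha> \<subseteq> {i \<in> {1..n}. b i = \<alpha>}" using b_T[OF that] T(2)[OF that] by blast
    show "{i \<in> {1..n}. b i = \<alpha>} \<subseteq> T \<alpha>"
    proof clarify
      fix i assume "\<alpha> = b i"
      then have "\<exists>\<alpha>\<in>{1..r}. i \<in> T \<alpha>" using that unfolding b_def by (auto split: if_splits)
      then show "i \<in> T (b i)" using b_T by blast
    qed
  qed
  have "(\<Sum>\<beta>=0..r. card {i \<in> {1..n}. b i = \<beta>}) = n"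
    using sum_card_fibres b_r by blast
  then have b0: "card {i \<in> {1..n}. b i = 0} = card (S 0)"
    using n0 Tb T(3) by (simp add: sum.atLeast_Suc_atMost)
  have "(\<Sum>i=1..n. Max ((\<lambda>\<beta>. t \<beta> + row M i \<beta>) ` {0..r})) = (\<Sum>i=1..n. t (a i) + row M i (a i))"
    using a(2) by simp
  also have "\<dots> \<le> (\<Sum>i=1..n. t (b i) + row N i (b i)) + \<epsilon>"
    unfolding sum_row_choice[of n a r, OF a(1)] sum_row_choice[of n b r, OF b_r] b0 S_def[symmetric]
    using MN Tb T(3) by (simp add: c_def)
  also have "\<dots> \<le> (\<Sum>i=1..n. Max ((\<lambda>\<beta>. t \<beta> + row N i \<beta>) ` {0..r})) + \<epsilon>"
    using b_r by (intro add_right_mono sum_mono Max_ge) auto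
  finally show ?thesis .
qed

text \<open>
  A mixed difference in \<open>r + 1\<close> directions is a signed sum of \<open>2 ^ (r + 1)\<close> values, which accounts for
  the constant.
\<close>

lemma sum_bump_close:
  assumes "0 \<le> \<epsilon>" "0 \<le> \<delta>"
    and close: "\<And>c. c \<in> exp_idx n r \<Longrightarrow> \<bar>basic n r c M - basic n r c N\<bar> \<le> \<epsilon>"
  shows "\<bar>(\<Sum>i=1..n. max 0 (\<delta> - spread r (\<lambda>\<beta>. row M i \<beta> - x \<beta>)))
    - (\<Sum>i=1..n. max 0 (\<delta> - spread r (\<lambda>\<beta>. row N i \<beta> - x \<beta>)))\<bar> \<le> 2 ^ (r + 1) * \<epsilon>"
proof -
  define H where "H L t = (\<Sum>i=1..n. Max ((\<lambda>\<beta>. t \<beta> + row L i \<beta>) ` {0..r}))" for L t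
  define t where "t A \<beta> = (if \<beta> \<in> A then \<delta> else 0) - x \<beta>" for A \<beta>
  have H: "\<bar>H M t - H N t\<bar> \<le> \<epsilon>" for t
  proof -
    have "basic n r c M \<le> basic n r c N + \<epsilon> \<and> basic n r c N \<le> basic n r c M + \<epsilon>"
      if "c \<in> exp_idx n r" for c using close[OF that] by linarith
    then have "H M t \<le> H N t + \<epsilon>" "H N t \<le> H M t + \<epsilon>"
      unfolding H_def by (intro sum_row_Max_le assms(1); blast)+
    then show ?thesis by linarith
  qed
  have bump: "(\<Sum>i=1..n. max 0 (\<delta> - spread r (\<lambda>\<beta>. row L i \<beta> - x \<beta>)))
      = - (\<Sum>A\<in>Pow {0..r}. (-1) ^ card A * H L (t A))" for L
  proof -
    have shift: "t A \<beta> + row L i \<beta> = (row L i \<beta> - x \<beta>) + (if \<beta> \<in> A then \<delta> else 0)" for A i \<beta>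
      unfolding t_def by simp
    then have "- max 0 (\<delta> - spread r (\<lambda>\<beta>. row L i \<beta> - x \<beta>))
        = (\<Sum>A\<in>Pow {0..r}. (-1) ^ card A * Max ((\<lambda>\<beta>. t A \<beta> + row L i \<beta>) ` {0..r}))" for i
      by (simp only: shift mixed_difference_Max[OF assms(2)])
    then have "- (\<Sum>i=1..n. max 0 (\<delta> - spread r (\<lambda>\<beta>. row L i \<beta> - x \<beta>)))
        = (\<Sum>i=1..n. \<Sum>A\<in>Pow {0..r}. (-1) ^ card A * Max ((\<lambda>\<beta>. t A \<beta> + row L i \<beta>) ` {0..r}))"
      by (simp only: sum_negf[symmetric])
    also have "\<dots> = (\<Sum>A\<in>Pow {0..r}. (-1) ^ card A * H L (t A))"
      unfolding H_def sum_distrib_left by (rule sum.swap)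
    finally show ?thesis by simp
  qed
  have "\<bar>(\<Sum>A\<in>Pow {0..r}. (-1) ^ card A * H N (t A)) - (\<Sum>A\<in>Pow {0..r}. (-1) ^ card A * H M (t A))\<bar>
      = \<bar>\<Sum>A\<in>Pow {0..r}. (-1) ^ card A * (H N (t A) - H M (t A))\<bar>"
    by (simp add: sum_subtractf right_diff_distrib)
  also have "\<dots> \<le> (\<Sum>A\<in>Pow {0..r}. \<bar>(-1) ^ card A * (H N (t A) - H M (t A))\<bar>)"
    by (rule sum_abs)
  also have "\<dots> \<le> (\<Sum>A\<in>Pow {0..r}. \<epsilon>)"
    using H by (intro sum_mono) (simp add: abs_mult power_abs abs_minus_commute)
  also have "\<dots> = 2 ^ (r + 1) * \<epsilon>" by (simp add: card_Pow)
  finally show ?thesis unfolding bump by simp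
qed

text \<open>
  Take a point \<open>P a\<close> and let \<open>\<delta>\<close> be its distance to the nearest \<open>Q b\<close>. The bumps of radius \<open>\<delta>\<close>
  around \<open>P a\<close> see no \<open>Q\<close> at all but give \<open>P a\<close> itself the weight \<open>\<delta>\<close>, so \<open>\<delta> \<le> E\<close>. Match \<open>a\<close> with
  this \<open>b\<close> and remove both; bumps being 1-Lipschitz in the centre, the error bound for the remaining
  points is at most \<open>E + \<delta> \<le> 2 * E\<close>.
\<close>

lemma greedy_matching:
  fixes d :: "'x \<Rightarrow> 'x \<Rightarrow> real"
  assumes nonneg: "\<And>u v. 0 \<le> d u v" and refl: "\<And>u. d u u = 0" and sym: "\<And>u v. d u v = d v u"
    and triangle: "\<And>u v w. d u w \<le> d u v + d v w"
    and "finite A" "finite B" "card A = card B" "0 \<le> E"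
    and "\<And>x \<delta>. 0 \<le> \<delta> \<Longrightarrow>
      \<bar>(\<Sum>a\<in>A. max 0 (\<delta> - d (P a) x)) - (\<Sum>b\<in>B. max 0 (\<delta> - d (Q b) x))\<bar> \<le> E"
  shows "\<exists>h. bij_betw h A B \<and> (\<forall>a\<in>A. d (P a) (Q (h a)) \<le> 2 ^ card A * E)"
  using assms(5-)
proof (induction A arbitrary: B E rule: finite_induct)
  case empty
  then show ?case by (auto simp: bij_betw_def)
next
  case (insert a A)
  have B: "B \<noteq> {}" using insert by auto
  obtain b where b: "b \<in> B" "\<And>b'. b' \<in> B \<Longrightarrow> d (P a) (Q b) \<le> d (P a) (Q b')"
    using ex_min_if_finite[of "(\<lambda>b. d (P a) (Q b)) ` B"] B insert(4)
    by (metis (no_types, lifting) arg_min_if_finite(1) arg_min_least)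
  define \<delta> where "\<delta> = d (P a) (Q b)"
  have "\<delta> \<le> E"
  proof -
    have "max 0 (\<delta> - d (Q b') (P a)) = 0" if "b' \<in> B" for b'
      using b(2)[OF that] unfolding \<delta>_def by (simp add: sym)
    then have "(\<Sum>b\<in>B. max 0 (\<delta> - d (Q b) (P a))) = 0" by simp
    moreover have "\<delta> \<le> (\<Sum>a'\<in>insert a A. max 0 (\<delta> - d (P a') (P a)))"
      using member_le_sum[of a "insert a A" "\<lambda>a'. max 0 (\<delta> - d (P a') (P a))"] insert(1) refl
      by simp
    moreover have "0 \<le> \<delta>" unfolding \<delta>_def by (rule nonneg)
    ultimately show ?thesis using insert.prems(4)[of \<delta> "P a"] by linarith
  qed
  have "\<exists>h. bij_betw h A (B - {b}) \<and> (\<forall>a\<in>A. d (P a) (Q (h a)) \<le> 2 ^ card A * (2 * E))"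
  proof (rule insert.IH)
    show "finite (B - {b})" using insert by simp
    show "card A = card (B - {b})" using insert b by simp
    show "0 \<le> 2 * E" using insert by simp
    fix x :: 'x and \<eta> :: real assume \<eta>: "0 \<le> \<eta>"
    have "\<bar>max 0 (\<eta> - d (P a) x) - max 0 (\<eta> - d (Q b) x)\<bar> \<le> \<delta>"
      using triangle[of "P a" x "Q b"] triangle[of "Q b" x "P a"] sym[of "Q b" "P a"]
        nonneg[of "P a" "Q b"] unfolding \<delta>_def by linarith
    moreover have "\<bar>(max 0 (\<eta> - d (P a) x) + (\<Sum>a\<in>A. max 0 (\<eta> - d (P a) x))) -
      (max 0 (\<eta> - d (Q b) x) + (\<Sum>b\<in>B - {b}. max 0 (\<eta> - d (Q b) x)))\<bar> \<le> E"
      using insert.prems(4)[OF \<eta>, of x] insert(1,2,4) b(1)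
      by (simp add: sum.remove[of B b])
    ultimately show "\<bar>(\<Sum>a\<in>A. max 0 (\<eta> - d (P a) x)) - (\<Sum>b\<in>B - {b}. max 0 (\<eta> - d (Q b) x))\<bar>
        \<le> 2 * E"
      using \<open>\<delta> \<le> E\<close> by linarith
  qed
  then obtain h where h: "bij_betw h A (B - {b})"
    "\<And>a. a \<in> A \<Longrightarrow> d (P a) (Q (h a)) \<le> 2 ^ card A * (2 * E)" by blast
  show ?case
  proof (intro exI[of _ "h(a := b)"] conjI ballI)
    have "bij_betw (h(a := b)) A (B - {b})"
      using h(1) insert(2) by (subst bij_betw_cong[where g = h]) auto
    then show "bij_betw (h(a := b)) (insert a A) B"
      using notIn_Un_bij_betw[of a A "h(a := b)" "B - {b}"] insert(2) b(1)
      by (simp add: insert_absorb)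
    fix a' assume a': "a' \<in> insert a A"
    have "\<delta> \<le> 2 ^ card (insert a A) * E"
      using \<open>\<delta> \<le> E\<close> mult_right_mono[of 1 "2 ^ card (insert a A)" E] insert.prems(3) by simp
    then show "d (P a') (Q ((h(a := b)) a')) \<le> 2 ^ card (insert a A) * E"
      using a' h(2)[of a'] insert(1,2) unfolding \<delta>_def by (auto simp: mult.assoc)
  qed
qed

text \<open>
  Together with the invariance of the basic values this says that they embed the space of matrices
  modulo row permutations with a Lipschitz inverse on the image.
\<close>

lemma rows_matching:
  assumes "0 \<le> \<epsilon>"
    and close: "\<And>c. c \<in> exp_idx n r \<Longrightarrow> \<bar>basic n r c M - basic n r c N\<bar> \<le> \<epsilon>"
  obtains \<pi> where "\<pi> permutes {1..n}"
    "\<And>v. v \<in> mat_idx n r \<Longrightarrow> \<bar>M v - permute_rows \<pi> N v\<bar> \<le> 2 ^ (n + r + 1) * \<epsilon>"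
proof -
  let ?d = "\<lambda>u v. spread r (\<lambda>\<beta>. u \<beta> - v \<beta>)"
  have "\<exists>h. bij_betw h {1..n} {1..n} \<and>
      (\<forall>i\<in>{1..n}. ?d (row M i) (row N (h i)) \<le> 2 ^ card {1..n} * (2 ^ (r + 1) * \<epsilon>))"
  proof (rule greedy_matching[where d = ?d and P = "row M" and Q = "row N"])
    show "?d u u = 0" for u using spread_attained[of r "\<lambda>\<beta>. u \<beta> - u \<beta>"] by auto
    show "?d u w \<le> ?d u v + ?d v w" for u v w by (rule spread_triangle)
    show "?d u v = ?d v u" for u v by (rule spread_commute)
  qed (use assms sum_bump_close[of \<epsilon> _ n r M N] in \<open>auto simp: spread_nonneg\<close>)
  then obtain h where h: "bij_betw h {1..n} {1..n}"
    "\<And>i. i \<in> {1..n} \<Longrightarrow> ?d (row M i) (row N (h i)) \<le> 2 ^ card {1..n} * (2 ^ (r + 1) * \<epsilon>)"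
    by blast
  define \<pi> where "\<pi> i = (if i \<in> {1..n} then h i else i)" for i
  have "bij_betw \<pi> {1..n} {1..n}"
    using h(1) unfolding \<pi>_def by (subst bij_betw_cong[where g = h]) auto
  then have perm: "\<pi> permutes {1..n}"
    by (rule bij_imp_permutes) (simp only: \<pi>_def if_False)
  show ?thesis
  proof (rule that[OF perm])
    fix v assume "v \<in> mat_idx n r"
    then obtain i \<alpha> where v: "v = (i, \<alpha>)" "i \<in> {1..n}" "\<alpha> \<in> {1..r}" unfolding mat_idx_def by auto
    have eps: "2 ^ card {1..n} * (2 ^ (r + 1) * \<epsilon>) = 2 ^ (n + r + 1) * \<epsilon>"
      by (simp add: power_add)
    \<comment> \<open>Both rows vanish at \<open>0\<close>, so comparing position \<open>\<alpha>\<close> with position \<open>0\<close> bounds the entry.\<close>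
    have "\<bar>row M i \<alpha> - row N (h i) \<alpha>\<bar> \<le> ?d (row M i) (row N (h i))"
      using le_spread[of \<alpha> r 0 "\<lambda>\<beta>. row M i \<beta> - row N (h i) \<beta>"]
        le_spread[of 0 r \<alpha> "\<lambda>\<beta>. row M i \<beta> - row N (h i) \<beta>"] v(3)
      by (simp add: row_def abs_le_iff)
    then have "\<bar>row M i \<alpha> - row N (h i) \<alpha>\<bar> \<le> 2 ^ (n + r + 1) * \<epsilon>"
      using h(2)[OF v(2)] eps by linarith
    then show "\<bar>M v - permute_rows \<pi> N v\<bar> \<le> 2 ^ (n + r + 1) * \<epsilon>"
      using v by (simp add: row_def permute_rows_def \<pi>_def)
  qed
qed

section \<open>Recovering the sorted columns and a coupling\<close>

text \<open>Selection sort: move a smallest value to the last position and sort the rest.\<close>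

lemma exists_sorting_permutation:
  fixes x :: "nat \<Rightarrow> real"
  shows "\<exists>\<pi>. \<pi> permutes {1..n} \<and> (\<forall>i j. 1 \<le> i \<longrightarrow> i \<le> j \<longrightarrow> j \<le> n \<longrightarrow> x (\<pi> j) \<le> x (\<pi> i))"
proof (induction n arbitrary: x)
  case 0
  then show ?case by (auto intro: exI[of _ id])
next
  case (Suc n)
  obtain k where k: "k \<in> {1..Suc n}" "\<And>j. j \<in> {1..Suc n} \<Longrightarrow> x k \<le> x j"
    using arg_min_if_finite(1)[of "{1..Suc n}" x] arg_min_least[of "{1..Suc n}" _ x]
    by (metis atLeastAtMost_iff empty_iff finite_atLeastAtMost le_add1 order_refl plus_1_eq_Suc)
  let ?\<tau> = "transpose k (Suc n)"
  have \<tau>: "?\<tau> permutes {1..Suc n}" using k by (intro permutes_swap_id) auto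
  obtain \<pi> where \<pi>: "\<pi> permutes {1..n}"
    "\<And>i j. 1 \<le> i \<Longrightarrow> i \<le> j \<Longrightarrow> j \<le> n \<Longrightarrow> x (?\<tau> (\<pi> j)) \<le> x (?\<tau> (\<pi> i))"
    using Suc[of "x \<circ> ?\<tau>"] by auto
  have \<pi>': "\<pi> permutes {1..Suc n}" using \<pi>(1) by (rule permutes_subset) auto
  have perm: "(?\<tau> \<circ> \<pi>) permutes {1..Suc n}" by (rule permutes_compose[OF \<pi>' \<tau>])
  have last: "(?\<tau> \<circ> \<pi>) (Suc n) = k" using permutes_not_in[OF \<pi>(1), of "Suc n"] by simp
  have "x ((?\<tau> \<circ> \<pi>) j) \<le> x ((?\<tau> \<circ> \<pi>) i)" if ij: "1 \<le> i" "i \<le> j" "j \<le> Suc n" for i j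
  proof (cases "j = Suc n")
    case True
    have "(?\<tau> \<circ> \<pi>) i \<in> {1..Suc n}" using permutes_in_image[OF perm] ij by simp
    then show ?thesis using k(2) last True by metis
  next
    case False
    then show ?thesis using \<pi>(2) ij by simp
  qed
  then show ?case using perm by blast
qed

text \<open>
  The indices of \<open>T\<close> outside the initial segment are as many as those of the segment outside \<open>T\<close>,
  and \<open>x (card T)\<close> separates the values at the former from the larger values at the latter.
\<close>

lemma sum_le_sum_initial:
  fixes x :: "nat \<Rightarrow> real"
  assumes anti: "\<And>i j. 1 \<le> i \<Longrightarrow> i \<le> j \<Longrightarrow> j \<le> n \<Longrightarrow> x j \<le> x i"
    and T: "T \<subseteq> {1..n}"
  shows "sum x T \<le> sum x {1..card T}"
proof -
  let ?k = "card T"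
  let ?A = "{1..?k}"
  have fin: "finite T" using T finite_subset by blast
  have kn: "?k \<le> n" using card_mono[OF _ T] by simp
  have "card (T - ?A) = card (?A - T)"
  proof -
    have "card (T - ?A) = ?k - card (T \<inter> ?A)" using fin by (simp add: card_Diff_subset_Int)
    moreover have "card (?A - T) = ?k - card (T \<inter> ?A)" by (simp add: card_Diff_subset_Int Int_commute)
    ultimately show ?thesis by simp
  qed
  moreover have "sum x (T - ?A) \<le> of_nat (card (T - ?A)) * x ?k"
  proof (rule sum_bounded_above)
    fix i assume i: "i \<in> T - ?A"
    then have "0 < ?k" using fin card_gt_0_iff by blast
    then show "x i \<le> x ?k" using i T by (intro anti) auto
  qed
  moreover have "of_nat (card (?A - T)) * x ?k \<le> sum x (?A - T)"
    by (rule sum_bounded_below) (use anti kn in auto)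
  ultimately have "sum x (T - ?A) \<le> sum x (?A - T)" by simp
  moreover have "sum x T = sum x (T \<inter> ?A) + sum x (T - ?A)"
    using fin by (rule sum.Int_Diff)
  moreover have "sum x ?A = sum x (?A \<inter> T) + sum x (?A - T)"
    by (rule sum.Int_Diff) simp
  ultimately show ?thesis by (simp add: Int_commute)
qed

lemma mult_unit_in_exp_idx:
  assumes "i \<in> {1..n}" "\<alpha> \<in> {1..r}"
  shows "mult_unit i \<alpha> \<in> exp_idx n r"
  using assms unfolding exp_idx_def mult_unit_def by auto

lemma basic_mult_unit:
  assumes \<alpha>: "\<alpha> \<in> {1..r}" and i: "i \<le> n" and \<pi>: "\<pi> permutes {1..n}"
    and anti: "\<And>i j. 1 \<le> i \<Longrightarrow> i \<le> j \<Longrightarrow> j \<le> n \<Longrightarrow> M (\<pi> j, \<alpha>) \<le> M (\<pi> i, \<alpha>)"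
  shows "basic n r (mult_unit i \<alpha>) M = (\<Sum>j=1..i. M (\<pi> j, \<alpha>))"
proof (rule antisym)
  note inj = permutes_inj_on[OF \<pi>]
  have single: "(\<Sum>\<beta>=1..r. \<Sum>j\<in>S \<beta>. M (j, \<beta>)) = (\<Sum>j\<in>S \<alpha>. M (j, \<alpha>))"
    if "\<And>\<beta>. \<beta> \<in> {1..r} \<Longrightarrow> \<beta> \<noteq> \<alpha> \<Longrightarrow> S \<beta> = {}" for S
    using sum.mono_neutral_right[of "{1..r}" "{\<alpha>}" "\<lambda>\<beta>. \<Sum>j\<in>S \<beta>. M (j, \<beta>)"] \<alpha> that by auto
  show "basic n r (mult_unit i \<alpha>) M \<le> (\<Sum>j=1..i. M (\<pi> j, \<alpha>))"
  proof -
    have "(\<Sum>\<beta>=1..r. mult_unit i \<alpha> \<beta>) \<le> n" using \<alpha> i by (simp add: mult_unit_def)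
    from basic_attained[OF this, of M] obtain S
      where S: "\<And>\<beta>. \<beta> \<in> {1..r} \<Longrightarrow> S \<beta> \<subseteq> {1..n}"
      "\<And>\<beta>. \<beta> \<in> {1..r} \<Longrightarrow> card (S \<beta>) = mult_unit i \<alpha> \<beta>"
      "basic n r (mult_unit i \<alpha>) M = (\<Sum>\<beta>=1..r. \<Sum>j\<in>S \<beta>. M (j, \<beta>))" by metis
    have "S \<beta> = {}" if "\<beta> \<in> {1..r}" "\<beta> \<noteq> \<alpha>" for \<beta>
      using S(1,2)[OF that(1)] that(2) finite_subset[of "S \<beta>" "{1..n}"] by (auto simp: mult_unit_def)
    then have e: "basic n r (mult_unit i \<alpha>) M = (\<Sum>j\<in>S \<alpha>. M (j, \<alpha>))"
      using S(3) single by simp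
    define T where "T = inv \<pi> ` S \<alpha>"
    have ST: "S \<alpha> = \<pi> ` T" unfolding T_def image_image using permutes_inverses(1)[OF \<pi>] by simp
    have "card T = i" using S(2)[OF \<alpha>] unfolding ST by (simp add: mult_unit_def card_image inj)
    moreover have "T \<subseteq> {1..n}"
      unfolding T_def using S(1)[OF \<alpha>] permutes_image[OF permutes_inv[OF \<pi>]] by blast
    ultimately have "(\<Sum>j\<in>T. M (\<pi> j, \<alpha>)) \<le> (\<Sum>j=1..i. M (\<pi> j, \<alpha>))"
      using sum_le_sum_initial[of n "\<lambda>j. M (\<pi> j, \<alpha>)" T] anti by simp
    then show ?thesis unfolding e ST by (simp add: sum.reindex inj)
  qed
  show "(\<Sum>j=1..i. M (\<pi> j, \<alpha>)) \<le> basic n r (mult_unit i \<alpha>) M"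
  proof -
    define S where "S \<beta> = (if \<beta> = \<alpha> then \<pi> ` {1..i} else {})" for \<beta>
    have "(\<Sum>j=1..i. M (\<pi> j, \<alpha>)) = (\<Sum>j\<in>S \<alpha>. M (j, \<alpha>))"
      unfolding S_def by (simp add: sum.reindex inj)
    also have "\<dots> = (\<Sum>\<beta>=1..r. \<Sum>j\<in>S \<beta>. M (j, \<beta>))" by (rule single[symmetric]) (simp add: S_def)
    also have "\<dots> \<le> basic n r (mult_unit i \<alpha>) M"
    proof (rule le_basic)
      show "disjoint_family_on S {1..r}" unfolding disjoint_family_on_def S_def by auto
      show "S \<beta> \<subseteq> {1..n}" for \<beta>
        unfolding S_def using i permutes_image[OF \<pi>] by (auto simp: permutes_in_image[OF \<pi>])
      show "card (S \<beta>) = mult_unit i \<alpha> \<beta>" for \<beta>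
        unfolding S_def mult_unit_def by (simp add: card_image inj)
    qed
    finally show ?thesis .
  qed
qed

lemma smap_Phi:
  assumes \<alpha>: "\<alpha> \<in> {1..r}" and i: "i \<in> {1..n}" and \<pi>: "\<pi> permutes {1..n}"
    and anti: "\<And>i j. 1 \<le> i \<Longrightarrow> i \<le> j \<Longrightarrow> j \<le> n \<Longrightarrow> M (\<pi> j, \<alpha>) \<le> M (\<pi> i, \<alpha>)"
  shows "smap (Phi n r M) (i, \<alpha>) = M (\<pi> i, \<alpha>)"
proof -
  have coord: "coord (Phi n r M) (mult_unit k \<alpha>) = (\<Sum>j=1..k. M (\<pi> j, \<alpha>))" if "k \<le> n" for k
  proof (cases "k = 0")
    case True
    then show ?thesis by (simp add: coord_def mult_unit_def)
  next
    case False
    then have "mult_unit k \<alpha> \<noteq> (\<lambda>_. 0)" by (auto simp: mult_unit_def fun_eq_iff)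
    then show ?thesis using basic_mult_unit[where M = M, OF \<alpha> that \<pi> anti] by (simp add: coord_def Phi_def)
  qed
  obtain k where "i = Suc k" using i by (cases i) auto
  then show ?thesis using coord[of i] coord[of k] i by (simp add: smap_def)
qed

text \<open>
  Let \<open>p \<alpha>\<close> sort column \<open>\<alpha>\<close>. The entry of the sorted column \<open>\<alpha>\<close> in position \<open>(p \<alpha>)\<inverse> (p 1 i)\<close> is
  the entry of \<open>M\<close> in row \<open>p 1 i\<close>, so these positions couple the sorted columns into \<open>M\<close> with its
  rows permuted by \<open>p 1\<close>.
\<close>

lemma exists_recoupling:
  assumes "r > 0"
  obtains \<sigma> \<pi> where "\<sigma> \<in> couplings n r" "\<pi> permutes {1..n}"
    "\<And>v. v \<in> mat_idx n r \<Longrightarrow> recouple \<sigma> (smap (Phi n r M)) v = permute_rows \<pi> M v"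
proof -
  obtain p where p: "\<And>\<alpha>. p \<alpha> permutes {1..n}"
    "\<And>\<alpha> i j. 1 \<le> i \<Longrightarrow> i \<le> j \<Longrightarrow> j \<le> n \<Longrightarrow> M (p \<alpha> j, \<alpha>) \<le> M (p \<alpha> i, \<alpha>)"
    using exists_sorting_permutation[of n "\<lambda>i. M (i, _)"] by metis
  define \<sigma> where "\<sigma> = (\<lambda>\<alpha>\<in>{2..r}. inv (p \<alpha>) \<circ> p 1)"
  have perm: "(inv (p \<alpha>) \<circ> p 1) permutes {1..n}" for \<alpha>
    by (rule permutes_compose[OF p(1) permutes_inv[OF p(1)]])
  show ?thesis
  proof (rule that[of \<sigma> "p 1"])
    show "\<sigma> \<in> couplings n r" unfolding couplings_def \<sigma>_def using perm by auto
    show "p 1 permutes {1..n}" by (rule p)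
    fix v assume "v \<in> mat_idx n r"
    then obtain i \<alpha> where v: "v = (i, \<alpha>)" "i \<in> {1..n}" "\<alpha> \<in> {1..r}" unfolding mat_idx_def by auto
    show "recouple \<sigma> (smap (Phi n r M)) v = permute_rows (p 1) M v"
    proof (cases "\<alpha> = 1")
      case True
      then show ?thesis
        using v smap_Phi[where M = M and \<pi> = "p 1", OF v(3,2) p(1)] p(2) by (simp add: recouple_def permute_rows_def)
    next
      case False
      let ?j = "(inv (p \<alpha>) \<circ> p 1) i"
      have "?j \<in> {1..n}" using v(2) permutes_in_image[OF perm] by blast
      then have "smap (Phi n r M) (?j, \<alpha>) = M (p \<alpha> ?j, \<alpha>)" 
        by (intro smap_Phi[where M = M, OF v(3) _ p(1)] p(2))
      moreover have "p \<alpha> ?j = p 1 i" using permutes_inverses(1)[OF p(1)] by simp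
      moreover have "\<sigma> \<alpha> = inv (p \<alpha>) \<circ> p 1" using False v(3) by (simp add: \<sigma>_def)
      ultimately show ?thesis using False v(1) by (simp add: recouple_def permute_rows_def)
    qed
  qed
qed

section \<open>The recoupling minimum\<close>

lemma semifield_basic_subset_sym_trop_rat:
  "trop_semifield (basic n r ` exp_idx n r) \<subseteq> sym_trop_rat n r"
proof -
  have rat: "basic n r ` exp_idx n r \<subseteq> trop_rat (mat_idx n r)"
    using basic_semifield_coords trop_rat_eq_semifield[OF finite_mat_idx] by auto
  have inv: "f (permute_rows \<pi> M) = f M"
    if "f \<in> trop_semifield (basic n r ` exp_idx n r)" "\<pi> permutes {1..n}" for f \<pi> M
    using that by induction (auto simp: basic_permute_rows)
  show ?thesis
    unfolding sym_trop_rat_def using inv semifield_subset_trop_rat[OF rat] by blast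
qed

lemma finite_couplings: "finite (couplings n r)"
  unfolding couplings_def by (intro finite_PiE) (auto simp: finite_permutations)

lemma couplings_nonempty: "couplings n r \<noteq> {}"
proof -
  have "(\<lambda>\<alpha>\<in>{2..r}. id) \<in> couplings n r" by (simp add: couplings_def permutes_id)
  then show ?thesis by blast
qed

lemma exp_idx_nonempty:
  assumes "n > 0" "r > 0"
  shows "exp_idx n r \<noteq> {}"
  using mult_unit_in_exp_idx[of 1 n 1 r] assms by auto

lemma recoupling_min_trop_rat:
  assumes "n > 0" "r > 0" and f: "f \<in> trop_rat (mat_idx n r)"
  shows "recoupling_min n r f \<kappa> \<in> trop_rat (exp_idx n r)"
proof -
  let ?F = "trop_semifield (coords (exp_idx n r))"
  have smap: "(\<lambda>w. smap w (i, \<alpha>)) \<in> ?F" if "i \<in> {1..n}" "\<alpha> \<in> {1..r}" for i \<alpha>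
  proof -
    have "(\<lambda>w. coord w (mult_unit k \<alpha>)) \<in> ?F" if "k \<le> n" for k
    proof (cases "k = 0")
      case True
      then show ?thesis by (simp add: coord_def mult_unit_def trop_semifield.const)
    next
      case False
      then have "mult_unit k \<alpha> \<noteq> (\<lambda>_. 0)" by (auto simp: mult_unit_def fun_eq_iff)
      moreover have "mult_unit k \<alpha> \<in> exp_idx n r"
        using \<open>\<alpha> \<in> {1..r}\<close> that False by (intro mult_unit_in_exp_idx) auto
      ultimately show ?thesis by (auto simp: coord_def intro: trop_semifield.gen)
    qed
    then show ?thesis unfolding smap_def using that by (auto intro: trop_semifield.minus)
  qed
  have rec: "(\<lambda>w. recouple \<sigma> (smap w) v) \<in> ?F"
    if \<sigma>: "\<sigma> \<in> couplings n r" and "v \<in> mat_idx n r" for \<sigma> v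
  proof -
    obtain i \<alpha> where v: "v = (i, \<alpha>)" "i \<in> {1..n}" "\<alpha> \<in> {1..r}"
      using \<open>v \<in> mat_idx n r\<close> unfolding mat_idx_def by auto
    show ?thesis
    proof (cases "\<alpha> = 1")
      case True
      then show ?thesis using smap[OF v(2,3)] v by (simp add: recouple_def)
    next
      case False
      then have "\<sigma> \<alpha> permutes {1..n}" using \<sigma> v(3) unfolding couplings_def by (auto simp: PiE_iff)
      then have "\<sigma> \<alpha> i \<in> {1..n}" using v(2) by (simp only: permutes_in_image)
      from smap[OF this v(3)] show ?thesis using False v(1) by (simp add: recouple_def)
    qed
  qed
  have disc: "discriminant n r \<sigma> \<in> ?F" if \<sigma>: "\<sigma> \<in> couplings n r" for \<sigma>
  proof -
    have "(\<lambda>w. \<bar>w c - basic n r c (recouple \<sigma> (smap w))\<bar>) \<in> ?F" if c: "c \<in> exp_idx n r" for c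
    proof (intro semifield_abs trop_semifield.minus)
      show "(\<lambda>w. w c) \<in> ?F" using c by (intro trop_semifield.gen) blast
      show "(\<lambda>w. basic n r c (recouple \<sigma> (smap w))) \<in> ?F"
        by (rule trop_rat_subst[of _ "mat_idx n r"])
          (use basic_semifield_coords[OF c] trop_rat_eq_semifield[OF finite_mat_idx] rec[OF \<sigma>] in auto)
    qed
    then show ?thesis
      unfolding discriminant_def[abs_def]
      by (intro semifield_Max finite_exp_idx exp_idx_nonempty assms)
  qed
  have "recoupling_min n r f \<kappa> \<in> ?F"
    unfolding recoupling_min_def[abs_def]
    by (intro semifield_Min finite_couplings couplings_nonempty trop_semifield.plus
        semifield_of_int_mult disc trop_rat_subst[OF f] rec)
  then show ?thesis using trop_rat_eq_semifield[OF finite_exp_idx] by blast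
qed

lemma sym_trop_rat_Lipschitz_Phi:
  assumes f: "f \<in> sym_trop_rat n r"
  obtains K where "0 \<le> K"
    "\<And>M N \<epsilon>. 0 \<le> \<epsilon> \<Longrightarrow> (\<And>c. c \<in> exp_idx n r \<Longrightarrow> \<bar>basic n r c M - basic n r c N\<bar> \<le> \<epsilon>)
      \<Longrightarrow> \<bar>f M - f N\<bar> \<le> K * \<epsilon>"
proof -
  have rat: "f \<in> trop_rat (mat_idx n r)"
    and inv: "\<And>\<pi> M. \<pi> permutes {1..n} \<Longrightarrow> f (permute_rows \<pi> M) = f M"
    using f unfolding sym_trop_rat_def by auto
  obtain L where L: "0 \<le> L" "\<And>z z' e. 0 \<le> e \<Longrightarrow> (\<And>v. v \<in> mat_idx n r \<Longrightarrow> \<bar>z v - z' v\<bar> \<le> e)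
      \<Longrightarrow> \<bar>f z - f z'\<bar> \<le> L * e"
    using trop_rat_Lipschitz[OF finite_mat_idx rat] by blast
  show ?thesis
  proof (rule that[of "L * 2 ^ (n + r + 1)"])
    show "0 \<le> L * 2 ^ (n + r + 1)" using L(1) by simp
    fix M N \<epsilon>
    assume \<epsilon>: "0 \<le> \<epsilon>" "\<And>c. c \<in> exp_idx n r \<Longrightarrow> \<bar>basic n r c M - basic n r c N\<bar> \<le> \<epsilon>"
    obtain \<pi> where \<pi>: "\<pi> permutes {1..n}"
      "\<And>v. v \<in> mat_idx n r \<Longrightarrow> \<bar>M v - permute_rows \<pi> N v\<bar> \<le> 2 ^ (n + r + 1) * \<epsilon>"
      using rows_matching[OF \<epsilon>] by blast
    have "\<bar>f M - f (permute_rows \<pi> N)\<bar> \<le> L * (2 ^ (n + r + 1) * \<epsilon>)"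
      using L(2)[of "2 ^ (n + r + 1) * \<epsilon>" M "permute_rows \<pi> N"] \<epsilon>(1) \<pi>(2) by simp
    then show "\<bar>f M - f N\<bar> \<le> L * 2 ^ (n + r + 1) * \<epsilon>" using inv[OF \<pi>(1)] by (simp add: mult.assoc)
  qed
qed

lemma recoupling_min_Phi:
  assumes n: "n > 0" and r: "r > 0" and f: "f \<in> sym_trop_rat n r"
  obtains \<kappa>\<^sub>0 :: int where "\<And>\<kappa> M. \<kappa> \<ge> \<kappa>\<^sub>0 \<Longrightarrow> recoupling_min n r f \<kappa> (Phi n r M) = f M"
proof -
  have rat: "f \<in> trop_rat (mat_idx n r)"
    and inv: "\<And>\<pi> M. \<pi> permutes {1..n} \<Longrightarrow> f (permute_rows \<pi> M) = f M"
    using f unfolding sym_trop_rat_def by auto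
  obtain K where K: "0 \<le> K"
    "\<And>M N \<epsilon>. 0 \<le> \<epsilon> \<Longrightarrow> (\<And>c. c \<in> exp_idx n r \<Longrightarrow> \<bar>basic n r c M - basic n r c N\<bar> \<le> \<epsilon>)
      \<Longrightarrow> \<bar>f M - f N\<bar> \<le> K * \<epsilon>"
    using sym_trop_rat_Lipschitz_Phi[OF f] by blast
  show ?thesis
  proof (rule that[of "\<lceil>K\<rceil>"])
    fix \<kappa> M assume \<kappa>: "\<kappa> \<ge> \<lceil>K\<rceil>"
    let ?w = "Phi n r M"
    let ?v = "\<lambda>\<sigma>. f (recouple \<sigma> (smap ?w)) + real_of_int \<kappa> * discriminant n r \<sigma> ?w"
    have lower: "f M \<le> ?v \<sigma>" for \<sigma>
    proof -
      let ?N = "recouple \<sigma> (smap ?w)"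
      have D: "\<bar>basic n r c M - basic n r c ?N\<bar> \<le> discriminant n r \<sigma> ?w" if "c \<in> exp_idx n r" for c
        unfolding discriminant_def Phi_def using that finite_exp_idx by (intro Max_ge) auto
      obtain c where "c \<in> exp_idx n r" using exp_idx_nonempty[OF n r] by blast
      with D have D0: "0 \<le> discriminant n r \<sigma> ?w" by (meson abs_ge_zero order_trans)
      have "f M - f ?N \<le> K * discriminant n r \<sigma> ?w" using K(2)[OF D0 D] by linarith
      also have "\<dots> \<le> real_of_int \<kappa> * discriminant n r \<sigma> ?w"
        using \<kappa> D0 by (intro mult_right_mono) (auto simp: ceiling_le_iff)
      finally show ?thesis by linarith
    qed
    obtain \<sigma> \<pi> where \<sigma>: "\<sigma> \<in> couplings n r" "\<pi> permutes {1..n}"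
      "\<And>v. v \<in> mat_idx n r \<Longrightarrow> recouple \<sigma> (smap ?w) v = permute_rows \<pi> M v"
      using exists_recoupling[OF r] by blast
    have same: "g (recouple \<sigma> (smap ?w)) = g (permute_rows \<pi> M)" if "g \<in> trop_rat (mat_idx n r)" for g
      using trop_rat_cong[OF finite_mat_idx that] \<sigma>(3) by blast
    have "basic n r c (recouple \<sigma> (smap ?w)) = basic n r c M" if "c \<in> exp_idx n r" for c
      using same[of "basic n r c"] basic_permute_rows[OF \<sigma>(2) that]
        basic_semifield_coords[OF that] trop_rat_eq_semifield[OF finite_mat_idx] by simp
    then have "(\<lambda>c. \<bar>?w c - basic n r c (recouple \<sigma> (smap ?w))\<bar>) ` exp_idx n r = {0}"
      using exp_idx_nonempty[OF n r] by (auto simp: Phi_def)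
    then have "discriminant n r \<sigma> ?w = 0" by (simp add: discriminant_def)
    then have "?v \<sigma> = f M" using same[OF rat] inv[OF \<sigma>(2)] by simp
    then show "recoupling_min n r f \<kappa> ?w = f M"
      unfolding recoupling_min_def
      using lower \<sigma>(1) finite_couplings by (intro Min_eqI) force+
  qed
qed

theorem theorem3p5:
  fixes n r :: nat
  assumes "n > 0" and "r > 0"
  shows "trop_semifield (basic n r ` exp_idx n r) = sym_trop_rat n r \<and>
    (\<forall>f\<in>sym_trop_rat n r. \<exists>g\<in>trop_rat (exp_idx n r). f = g \<circ> Phi n r) \<and>
    (\<forall>f\<in>sym_trop_rat n r. \<exists>\<kappa>\<^sub>0::int. \<forall>\<kappa>\<ge>\<kappa>\<^sub>0.
       recoupling_min n r f \<kappa> \<in> trop_rat (exp_idx n r) \<and>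
       f = recoupling_min n r f \<kappa> \<circ> Phi n r)"
proof -
  have explicit: "\<exists>\<kappa>\<^sub>0::int. \<forall>\<kappa>\<ge>\<kappa>\<^sub>0. recoupling_min n r f \<kappa> \<in> trop_rat (exp_idx n r) \<and>
      f = recoupling_min n r f \<kappa> \<circ> Phi n r" if f: "f \<in> sym_trop_rat n r" for f
  proof -
    have rat: "f \<in> trop_rat (mat_idx n r)" using f unfolding sym_trop_rat_def by blast
    obtain \<kappa>\<^sub>0 :: int where "\<And>\<kappa> M. \<kappa> \<ge> \<kappa>\<^sub>0 \<Longrightarrow> recoupling_min n r f \<kappa> (Phi n r M) = f M"
      using recoupling_min_Phi[OF assms f] by blast
    then show ?thesis
      using recoupling_min_trop_rat[OF assms rat] by (intro exI[of _ \<kappa>\<^sub>0]) (auto simp: fun_eq_iff)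
  qed
  then have factor: "\<exists>g\<in>trop_rat (exp_idx n r). f = g \<circ> Phi n r" if "f \<in> sym_trop_rat n r" for f
    using that by blast
  have "sym_trop_rat n r \<subseteq> trop_semifield (basic n r ` exp_idx n r)"
  proof
    fix f assume "f \<in> sym_trop_rat n r"
    then obtain g where g: "g \<in> trop_rat (exp_idx n r)" "f = g \<circ> Phi n r" using factor by blast
    have "(\<lambda>M. g (Phi n r M)) \<in> trop_semifield (basic n r ` exp_idx n r)"
      by (rule trop_rat_subst[OF g(1)]) (auto simp: Phi_def intro: trop_semifield.gen)
    then show "f \<in> trop_semifield (basic n r ` exp_idx n r)" using g(2) by (simp add: comp_def)
  qed
  then show ?thesis using semifield_basic_subset_sym_trop_rat explicit factor by blast
qed

end
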